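(* Let $\rho$ be a hereditary Kurosh–Amitsur radical such that $\rho(G)$ contains the soluble radical of $G$ for every finite group $G$, and let $\gamma=\rho\star\mathrm{F}^*\star\rho$. If $M$ is a maximal subgroup of a finite group $G$ and $h_\gamma(G)<\infty$, $h_\gamma(M)<\infty$, then $h_\gamma(G)-h_\gamma(M)\leq 1$.
   Context: All groups are finite. $\mathrm{F}^*$ assigns to each group $G$ its generalized Fitting subgroup $\mathrm{F}^*(G)$. The soluble radical of $G$ is its largest soluble normal subgroup. A functorial is a function $\gamma$ assigning to each (finite) group $G$ a subgroup $\gamma(G)$ of $G$ such that $f(\gamma(G))=\gamma(f(G))$ for every isomorphism $f:G\to G^*$ (so $\gamma(G)$ is characteristic in $G$). A functorial $\gamma$ is a hereditary Plotkin radical if: (P1) $f(\gamma(G))\subseteq\gamma(f(G))$ for every epimorphism $f:G\to G^*$; (P2) $\gamma(G)\cap N=\gamma(N)$ for every $N\trianglelefteq G$. It is a hereditary Kurosh–Amitsur radical if in addition (P3) $\gamma(G/\gamma(G))\simeq 1$ for every group $G$. For functorials $\gamma_1,\gamma_2$ the upper product $\gamma_2\star\gamma_1$ is the functorial defined by $(\gamma_2\star\gamma_1)(G)/\gamma_2(G)=\gamma_1(G/\gamma_2(G))$; this operation is associative. The $\gamma$-series of $G$ is defined by $\gamma_{(0)}(G)=1$ and $\gamma_{(i+1)}(G)/\gamma_{(i)}(G)=\gamma(G/\gamma_{(i)}(G))$. The $\gamma$-length $h_\gamma(G)$ is the least $h\geq 0$ with $\gamma_{(h)}(G)=G$, and $h_\gamma(G)=\infty$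 if there is no such $h$. *)

theory Defs
  imports "HOL-Algebra.Algebra" "HOL-Library.Extended_Nat"
begin

section \<open>Subgroups of a finite group\<close>

definition maximal_subgroup :: "'a set \<Rightarrow> ('a, 'm) monoid_scheme \<Rightarrow> bool" where
  "maximal_subgroup M G \<longleftrightarrow>
     subgroup M G \<and> M \<noteq> carrier G \<and>
     (\<forall>K. subgroup K G \<and> M \<subseteq> K \<longrightarrow> K = M \<or> K = carrier G)"

definition soluble_radical :: "('a, 'm) monoid_scheme \<Rightarrow> 'a set" where
  "soluble_radical G = (GREATEST S. S \<lhd> G \<and> solvable (G\<lparr>carrier := S\<rparr>))"

definition group_center :: "('a, 'm) monoid_scheme \<Rightarrow> 'a set" where
  "group_center G = {z \<in> carrier G. \<forall>g\<in>carrier G. z \<otimes>\<^bsub>G\<^esub> g = g \<otimes>\<^bsub>G\<^esub> z}"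

primrec lower_central :: "('a, 'm) monoid_scheme \<Rightarrow> nat \<Rightarrow> 'a set" where
  "lower_central G 0 = carrier G"
| "lower_central G (Suc n) =
     generate G (\<Union>h\<in>lower_central G n. \<Union>g\<in>carrier G.
       {h \<otimes>\<^bsub>G\<^esub> g \<otimes>\<^bsub>G\<^esub> inv\<^bsub>G\<^esub> h \<otimes>\<^bsub>G\<^esub> inv\<^bsub>G\<^esub> g})"

definition nilpotent_group :: "('a, 'm) monoid_scheme \<Rightarrow> bool" where
  "nilpotent_group G \<longleftrightarrow> group G \<and> (\<exists>n. lower_central G n = {\<one>\<^bsub>G\<^esub>})"

inductive subnormal :: "('a, 'm) monoid_scheme \<Rightarrow> 'a set \<Rightarrow> bool" for G where
  self: "subnormal G (carrier G)"
| step: "subnormal G K \<Longrightarrow> H \<lhd> G\<lparr>carrier := K\<rparr> \<Longrightarrow> subnormal G H"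

text \<open>A perfect group is quasisimple if its central quotient is simple; by perfectness that
  quotient is automatically nonabelian.\<close>

definition quasisimple :: "('a, 'm) monoid_scheme \<Rightarrow> bool" where
  "quasisimple G \<longleftrightarrow>
     group G \<and> derived G (carrier G) = carrier G \<and> simple_group (G Mod group_center G)"

definition component_of_group :: "'a set \<Rightarrow> ('a, 'm) monoid_scheme \<Rightarrow> bool" where
  "component_of_group L G \<longleftrightarrow> subnormal G L \<and> quasisimple (G\<lparr>carrier := L\<rparr>)"

definition Fitting :: "('a, 'm) monoid_scheme \<Rightarrow> 'a set" where
  "Fitting G = generate G (\<Union>{N. N \<lhd> G \<and> nilpotent_group (G\<lparr>carrier := N\<rparr>)})"

definition layer :: "('a, 'm) monoid_scheme \<Rightarrow> 'a set" where
  "layer G = generate G (\<Union>{L. component_of_group L G})"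

definition generalized_Fitting :: "('a, 'm) monoid_scheme \<Rightarrow> 'a set" where
  "generalized_Fitting G = Fitting G <#>\<^bsub>G\<^esub> layer G"

section \<open>Functorials\<close>

text \<open>A functorial is a function on the class of all finite groups.  Because it is compatible with
  isomorphisms it is determined by its values on the finite groups whose elements are natural
  numbers, and every finite group is isomorphic to one of those.  So functorials are functions on
  \<^typ>\<open>nat monoid\<close>, and their values at groups over other types, in particular at
  quotient groups, are obtained by transport along an isomorphism.\<close>

type_synonym group_functional = "nat monoid \<Rightarrow> nat set"

definition functorial :: "group_functional \<Rightarrow> bool" where
  "functorial \<gamma> \<longleftrightarrow>
     (\<forall>G. group G \<and> finite (carrier G) \<longrightarrow> subgroup (\<gamma> G) G) \<and>
     (\<forall>G H f. group G \<and> finite (carrier G) \<and> group H \<and> f \<in> iso G H \<longrightarrow> f ` \<gamma> G = \<gamma> H)"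

text \<open>For a functorial the choice of \<open>H\<close> and \<open>f\<close> below does not matter,
  see \<open>functorial_at_iso_nat\<close>.\<close>

definition functorial_at :: "group_functional \<Rightarrow> ('a, 'm) monoid_scheme \<Rightarrow> 'a set" where
  "functorial_at \<gamma> G =
     {x \<in> carrier G. \<exists>(H :: nat monoid) f. group H \<and> f \<in> iso G H \<and> f x \<in> \<gamma> H}"

definition hereditary_Plotkin_radical :: "group_functional \<Rightarrow> bool" where
  "hereditary_Plotkin_radical \<gamma> \<longleftrightarrow>
     functorial \<gamma> \<and>
     (\<forall>G H f. group G \<and> finite (carrier G) \<and> group H \<and> f \<in> epi G H \<longrightarrow> f ` \<gamma> G \<subseteq> \<gamma> H) \<and>
     (\<forall>G N. group G \<and> finite (carrier G) \<and> N \<lhd> G \<longrightarrow> \<gamma> G \<inter> N = \<gamma> (G\<lparr>carrier := N\<rparr>))"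

definition hereditary_Kurosh_Amitsur_radical :: "group_functional \<Rightarrow> bool" where
  "hereditary_Kurosh_Amitsur_radical \<gamma> \<longleftrightarrow>
     hereditary_Plotkin_radical \<gamma> \<and>
     (\<forall>G. group G \<and> finite (carrier G) \<longrightarrow>
        functorial_at \<gamma> (G Mod \<gamma> G) = {\<one>\<^bsub>G Mod \<gamma> G\<^esub>})"

definition upper_product :: "group_functional \<Rightarrow> group_functional \<Rightarrow> group_functional"
    (infixr "\<star>" 70) where
  "(\<gamma>2 \<star> \<gamma>1) G =
     {x \<in> carrier G. \<gamma>2 G #>\<^bsub>G\<^esub> x \<in> functorial_at \<gamma>1 (G Mod \<gamma>2 G)}"

primrec functorial_series :: "group_functional \<Rightarrow> ('a, 'm) monoid_scheme \<Rightarrow> nat \<Rightarrow> 'a set" where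
  "functorial_series \<gamma> G 0 = {\<one>\<^bsub>G\<^esub>}"
| "functorial_series \<gamma> G (Suc i) =
     {x \<in> carrier G. functorial_series \<gamma> G i #>\<^bsub>G\<^esub> x
        \<in> functorial_at \<gamma> (G Mod functorial_series \<gamma> G i)}"

text \<open>The infimum of the empty set is \<open>\<infinity>\<close>.\<close>

definition functorial_length :: "group_functional \<Rightarrow> ('a, 'm) monoid_scheme \<Rightarrow> enat" where
  "functorial_length \<gamma> G = Inf {enat h |h. functorial_series \<gamma> G h = carrier G}"

section \<open>Values at groups over arbitrary types\<close>

lemma finite_group_iso_nat:
  fixes G :: "('a, 'm) monoid_scheme"
  assumes "group G" "finite (carrier G)"
  obtains H :: "nat monoid" and f where "group H" "finite (carrier H)" "f \<in> iso G H"
proof -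
  interpret group G by fact
  obtain f :: "'a \<Rightarrow> nat" where f: "inj_on f (carrier G)"
    using assms(2) finite_imp_inj_to_nat_seg by metis
  define g where "g = inv_into (carrier G) f"
  define H :: "nat monoid" where
    "H = \<lparr>carrier = f ` carrier G, monoid.mult = \<lambda>x y. f (g x \<otimes>\<^bsub>G\<^esub> g y), one = f \<one>\<^bsub>G\<^esub>\<rparr>"
  have gf: "g (f x) = x" if "x \<in> carrier G" for x
    using f that by (simp add: g_def)
  have iso: "f \<in> iso G H"
    using f by (auto simp: iso_def hom_def bij_betw_def H_def gf)
  have "group (H\<lparr>one := f \<one>\<^bsub>G\<^esub>\<rparr>)"
    by (rule iso_imp_img_group[OF iso])
  then have "group H" by (simp add: H_def)
  moreover have "finite (carrier H)" using assms(2) by (simp add: H_def)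
  ultimately show ?thesis using that iso by blast
qed

lemma functorial_at_iso_nat:
  fixes H :: "nat monoid"
  assumes "functorial \<gamma>" "group G" "finite (carrier G)" "group H" "f \<in> iso G H"
  shows "f ` functorial_at \<gamma> G = \<gamma> H"
proof
  have fin: "finite (carrier H)"
    using assms(3,5) bij_betw_finite by (auto simp: iso_def)
  have sub: "\<gamma> H \<subseteq> carrier H"
    using assms(1,4) fin by (auto simp: functorial_def dest: subgroup.subset)
  show "\<gamma> H \<subseteq> f ` functorial_at \<gamma> G"
  proof
    fix y assume y: "y \<in> \<gamma> H"
    then obtain x where "x \<in> carrier G" "y = f x"
      using sub assms(5) by (auto simp: iso_def bij_betw_def)
    then show "y \<in> f ` functorial_at \<gamma> G"
      using y assms(4,5) by (auto simp: functorial_at_def)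
  qed
  show "f ` functorial_at \<gamma> G \<subseteq> \<gamma> H"
  proof
    fix y assume "y \<in> f ` functorial_at \<gamma> G"
    then obtain x and K :: "nat monoid" and k where
      x: "x \<in> carrier G" "y = f x" and K: "group K" "k \<in> iso G K" "k x \<in> \<gamma> K"
      by (auto simp: functorial_at_def)
    let ?h = "f \<circ> inv_into (carrier G) k"
    have "?h \<in> iso K H"
      using iso_set_trans[OF group.iso_set_sym[OF assms(2) K(2)] assms(5)] .
    moreover have "finite (carrier K)"
      using assms(3) K(2) bij_betw_finite by (auto simp: iso_def)
    ultimately have "?h ` \<gamma> K = \<gamma> H"
      using assms(1,4) K(1) unfolding functorial_def by blast
    moreover have "?h (k x) = y"
      using x K(2) by (simp add: iso_def bij_betw_def)
    ultimately show "y \<in> \<gamma> H" using K(3) by force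
  qed
qed

lemma functorial_at_nat:
  fixes G :: "nat monoid"
  assumes "functorial \<gamma>" "group G" "finite (carrier G)"
  shows "functorial_at \<gamma> G = \<gamma> G"
  using functorial_at_iso_nat[OF assms assms(2) iso_set_refl] by simp

end

theory Submission
  imports Defs
begin

text \<open>Each step of the \<open>\<gamma>\<close>-series is \<open>\<rho>\<close>, then \<open>F*\<close>, then \<open>\<rho>\<close>; since \<open>\<rho>\<close> is idempotent, the series
  alternates \<open>\<rho>\<close> and \<open>F*\<close>.  Where \<open>F*\<close> is applied the group has trivial \<open>\<rho>\<close>, hence no soluble
  subnormal subgroup except \<open>1\<close>, so \<open>F*\<close> is generated by the simple subnormal subgroups and has
  trivial centraliser.

  Start the alternating series of \<open>G\<close> and of \<open>M\<close> at a common normal subgroup \<open>N \<subseteq> M\<close> and let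
  \<open>S \<supseteq> R \<supseteq> N\<close> be the first \<open>F*\<close> and \<open>\<rho>\<close> terms in \<open>G\<close>.  If \<open>S\<close> is not contained in \<open>M\<close>, then \<open>G = S M\<close>, so
  \<open>G / S\<close> is a quotient of \<open>M\<close> and is at most as long as \<open>M\<close>.  If \<open>S \<subseteq> M\<close>, then, because \<open>S / R\<close> has trivial
  centraliser in \<open>G / R\<close>, the series of \<open>M\<close> begins with the same \<open>R\<close> and \<open>S\<close>, and one continues with \<open>S\<close> in
  place of \<open>N\<close>.\<close>

section \<open>Subnormal simple subgroups\<close>

lemma (in group) normal_in_subgroup_iff:
  assumes "subgroup K G"
  shows "N \<lhd> G\<lparr>carrier := K\<rparr> \<longleftrightarrow>
    subgroup N G \<and> N \<subseteq> K \<and> (\<forall>k\<in>K. \<forall>n\<in>N. k \<otimes> n \<otimes> inv k \<in> N)"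
proof -
  interpret K: group "G\<lparr>carrier := K\<rparr>" using assms by (rule subgroup_imp_group)
  have "subgroup N (G\<lparr>carrier := K\<rparr>) \<longleftrightarrow> subgroup N G \<and> N \<subseteq> K"
    using incl_subgroup[OF assms] subgroup_incl[OF _ assms] subgroup.subset by fastforce
  then show ?thesis
    using assms by (auto simp: K.normal_inv_iff)
qed

lemma (in group) normal_imp_subnormal: "N \<lhd> G \<Longrightarrow> subnormal G N"
  using subnormal.step[OF subnormal.self, of N G] by simp

lemma (in group) subnormal_imp_subgroup: "subnormal G H \<Longrightarrow> subgroup H G"
  by (induction rule: subnormal.induct)
    (auto simp: subgroup_self intro: incl_subgroup dest: normal_imp_subgroup)

text \<open>Intersecting every term of the subnormal chain with \<open>M\<close> keeps each term
  normal in the previous one: conjugation by elements of \<open>K \<inter> M\<close> maps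
  \<open>H \<inter> M\<close> into both \<open>H\<close> and \<open>M\<close>.\<close>

lemma (in group) subnormal_Int_subgroup:
  assumes "subnormal G H" "subgroup M G"
  shows "subnormal (G\<lparr>carrier := M\<rparr>) (H \<inter> M)"
  using assms(1)
proof (induction rule: subnormal.induct)
  case self
  have "carrier G \<inter> M = M" using subgroup.subset[OF assms(2)] by blast
  then show ?case using subnormal.self[of "G\<lparr>carrier := M\<rparr>"] by simp
next
  case (step K H)
  have K: "subgroup K G" by (rule subnormal_imp_subgroup[OF step.hyps(1)])
  have "subgroup (H \<inter> M) G" "subgroup (K \<inter> M) G"
    using step.hyps(2) K assms(2) by (auto simp: normal_in_subgroup_iff intro: subgroups_Inter_pair)
  moreover have "k \<otimes> n \<otimes> inv k \<in> M" if "k \<in> M" "n \<in> M" for k n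
    using that assms(2) by (meson subgroup.m_closed subgroup.m_inv_closed)
  ultimately have "H \<inter> M \<lhd> G\<lparr>carrier := K \<inter> M\<rparr>"
    using step.hyps(2) K by (auto simp: normal_in_subgroup_iff)
  then show ?case using subnormal.step[OF step.IH] by simp
qed

lemma (in group) subnormal_restrict:
  assumes "subnormal G H" "subgroup M G" "H \<subseteq> M"
  shows "subnormal (G\<lparr>carrier := M\<rparr>) H"
  using subnormal_Int_subgroup[OF assms(1,2)] assms(3) by (simp add: Int_absorb2)

lemma (in group_hom) normal_image:
  assumes "subgroup K G" "N \<lhd> G\<lparr>carrier := K\<rparr>"
  shows "h ` N \<lhd> H\<lparr>carrier := h ` K\<rparr>"
proof -
  have N: "subgroup N G" "N \<subseteq> K" "\<And>k n. k \<in> K \<Longrightarrow> n \<in> N \<Longrightarrow> k \<otimes> n \<otimes> inv k \<in> N"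
    using assms by (auto simp: G.normal_in_subgroup_iff)
  have car: "x \<in> carrier G" if "x \<in> K" for x using assms(1) that subgroup.mem_carrier by metis
  have "h k \<otimes>\<^bsub>H\<^esub> h n \<otimes>\<^bsub>H\<^esub> inv\<^bsub>H\<^esub> h k \<in> h ` N" if "k \<in> K" "n \<in> N" for k n
  proof -
    have "h k \<otimes>\<^bsub>H\<^esub> h n \<otimes>\<^bsub>H\<^esub> inv\<^bsub>H\<^esub> h k = h (k \<otimes> n \<otimes> inv k)"
      using that N(2) car by (auto simp: subset_iff)
    then show ?thesis using N(3)[OF that] by simp
  qed
  then show ?thesis
    using N subgroup_img_is_subgroup[OF assms(1)] subgroup_img_is_subgroup[OF N(1)]
    by (auto simp: H.normal_in_subgroup_iff)
qed

lemma (in group_hom) subnormal_image: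
  assumes "h ` carrier G = carrier H" "subnormal G L"
  shows "subnormal H (h ` L)"
  using assms(2)
proof (induction rule: subnormal.induct)
  case self
  then show ?case using assms(1) subnormal.self by metis
next
  case (step K L)
  then show ?case
    using subnormal.step normal_image G.subnormal_imp_subgroup by metis
qed

text \<open>The kernel of \<open>h\<close> restricted to \<open>L\<close> is normal in
  \<open>L\<close>, so by simplicity the restriction is either trivial or injective.\<close>

lemma (in group_hom) simple_group_image:
  assumes "subgroup L G" "simple_group (G\<lparr>carrier := L\<rparr>)"
  shows "h ` L = {\<one>\<^bsub>H\<^esub>} \<or> simple_group (H\<lparr>carrier := h ` L\<rparr>)"
proof -
  interpret L: simple_group "G\<lparr>carrier := L\<rparr>" by fact
  interpret h: group_hom "G\<lparr>carrier := L\<rparr>" "H\<lparr>carrier := h ` L\<rparr>" h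
    by (rule induced_group_hom[OF assms(1)])
  consider "kernel (G\<lparr>carrier := L\<rparr>) (H\<lparr>carrier := h ` L\<rparr>) h = L"
    | "kernel (G\<lparr>carrier := L\<rparr>) (H\<lparr>carrier := h ` L\<rparr>) h = {\<one>}"
    using L.no_real_normal_subgroup[OF h.normal_kernel] by auto
  then show ?thesis
  proof cases
    case 1
    then have "h ` L \<subseteq> {\<one>\<^bsub>H\<^esub>}" by (auto simp: kernel_def)
    moreover have "\<one>\<^bsub>H\<^esub> \<in> h ` L"
      using subgroup.one_closed[OF assms(1)] hom_one by (metis imageI)
    ultimately show ?thesis by blast
  next
    case 2
    then have "h \<in> iso (G\<lparr>carrier := L\<rparr>) (H\<lparr>carrier := h ` L\<rparr>)"
      using h.trivial_ker_imp_inj by (simp add: iso_iff_mon_epi mon_def epi_def h.homh)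
    then show ?thesis using L.iso_simple[OF h.H.is_group] by blast
  qed
qed

text \<open>Take a nontrivial subnormal subgroup inside \<open>H\<close> of least cardinality. Its
  normal subgroups are again subnormal, so minimality makes it simple.\<close>

lemma (in group) subnormal_contains_simple:
  assumes "finite (carrier G)" "subnormal G H" "H \<noteq> {\<one>}"
  obtains L where "subnormal G L" "L \<subseteq> H" "simple_group (G\<lparr>carrier := L\<rparr>)"
proof -
  define P where "P L \<longleftrightarrow> subnormal G L \<and> L \<subseteq> H \<and> L \<noteq> {\<one>}" for L
  have "P H" using assms by (simp add: P_def)
  then obtain L where L: "P L" and min: "\<And>K. P K \<Longrightarrow> card L \<le> card K"
    using ex_has_least_nat[of P H card] by blast
  have sub: "subgroup L G" using L subnormal_imp_subgroup by (auto simp: P_def)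
  then have fin: "finite L" using assms(1) finite_subset subgroup.subset by metis
  interpret L: group "G\<lparr>carrier := L\<rparr>" using sub by (rule subgroup_imp_group)
  have "simple_group (G\<lparr>carrier := L\<rparr>)"
  proof
    have "card L \<noteq> 1"
      using L L.order_one_triv_iff by (auto simp: P_def order_def)
    moreover have "card L \<noteq> 0" using fin subgroup.one_closed[OF sub] by auto
    ultimately show "order (G\<lparr>carrier := L\<rparr>) > 1" by (simp add: order_def)
    fix N assume N: "N \<lhd> G\<lparr>carrier := L\<rparr>"
    then have NL: "N \<subseteq> L" using sub by (simp add: normal_in_subgroup_iff)
    have "N = L" if "N \<noteq> {\<one>}"
    proof -
      have "P N" using L N NL that by (auto simp: P_def intro: subnormal.step)
      then show ?thesis using min NL fin card_seteq by metis
    qed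
    then show "N = carrier (G\<lparr>carrier := L\<rparr>) \<or> N = {\<one>\<^bsub>G\<lparr>carrier := L\<rparr>\<^esub>}" by auto
  qed
  then show ?thesis using that L by (auto simp: P_def)
qed

section \<open>The subgroup generated by the simple subnormal subgroups\<close>

text \<open>Stands in for \<open>generalized_Fitting\<close>: the two agree wherever the series
  applies F*, and compatibility with epimorphisms follows directly from
  \<open>simple_group_image\<close>. Simple subgroups of prime order are allowed.\<close>

definition simple_socle :: "('a, 'm) monoid_scheme \<Rightarrow> 'a set" where
  "simple_socle G = generate G (\<Union>{L. subnormal G L \<and> simple_group (G\<lparr>carrier := L\<rparr>)})"

lemma (in group) simple_socle_generators_subset:
  "\<Union>{L. subnormal G L \<and> simple_group (G\<lparr>carrier := L\<rparr>)} \<subseteq> carrier G"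
  using subnormal_imp_subgroup subgroup.subset by fastforce

lemma (in group) simple_socle_subgroup: "subgroup (simple_socle G) G"
  unfolding simple_socle_def by (rule generate_is_subgroup[OF simple_socle_generators_subset])

lemma (in group) simple_subnormal_le_socle:
  assumes "subnormal G L" "simple_group (G\<lparr>carrier := L\<rparr>)"
  shows "L \<subseteq> simple_socle G"
  using assms by (auto simp: simple_socle_def intro: generate.incl)

lemma (in group_hom) simple_socle_image:
  assumes "h ` carrier G = carrier H"
  shows "h ` simple_socle G \<subseteq> simple_socle H"
proof -
  have "h ` (\<Union>{L. subnormal G L \<and> simple_group (G\<lparr>carrier := L\<rparr>)}) \<subseteq> simple_socle H"
  proof -
    have "h ` L \<subseteq> simple_socle H"
      if L: "subnormal G L" "simple_group (G\<lparr>carrier := L\<rparr>)" for L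
    proof -
      have "subgroup L G" using L(1) by (rule G.subnormal_imp_subgroup)
      then show ?thesis
        using simple_group_image[OF _ L(2)] subnormal_image[OF assms L(1)]
          H.simple_subnormal_le_socle subgroup.one_closed[OF H.simple_socle_subgroup]
        by (metis empty_subsetI insert_subset)
    qed
    then show ?thesis by blast
  qed
  then show ?thesis
    unfolding simple_socle_def[of G] generate_img[OF G.simple_socle_generators_subset, symmetric]
    by (rule H.generate_subgroup_incl[OF _ H.simple_socle_subgroup])
qed

text \<open>Together with \<open>m_assoc\<close> these rules let the simplifier normalise words
  containing inverses.\<close>

lemma (in group) inv_cancel_left [simp]:
  assumes "x \<in> carrier G" "y \<in> carrier G"
  shows "inv x \<otimes> (x \<otimes> y) = y" "x \<otimes> (inv x \<otimes> y) = y"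
  using assms by (simp_all flip: m_assoc)

lemma (in group) conjugation_iso:
  assumes "g \<in> carrier G"
  shows "(\<lambda>x. g \<otimes> x \<otimes> inv g) \<in> iso G G"
proof (rule isoI)
  show "(\<lambda>x. g \<otimes> x \<otimes> inv g) \<in> hom G G"
    using assms by (auto intro!: homI simp: m_assoc)
  show "bij_betw (\<lambda>x. g \<otimes> x \<otimes> inv g) (carrier G) (carrier G)"
    by (rule bij_betw_byWitness[where f' = "\<lambda>x. inv g \<otimes> x \<otimes> g"])
      (use assms in \<open>auto simp: m_assoc\<close>)
qed

text \<open>Conjugations are surjective endomorphisms, so \<open>simple_socle_image\<close> applies
  to them.\<close>

lemma (in group) simple_socle_normal: "simple_socle G \<lhd> G"
proof -
  have "g \<otimes> x \<otimes> inv g \<in> simple_socle G" if g: "g \<in> carrier G" and x: "x \<in> simple_socle G" for g x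
  proof -
    have c: "(\<lambda>y. g \<otimes> y \<otimes> inv g) \<in> iso G G" by (rule conjugation_iso[OF g])
    interpret c: group_hom G G "\<lambda>y. g \<otimes> y \<otimes> inv g"
      using c by unfold_locales (simp add: iso_def)
    show ?thesis using c c.simple_socle_image x by (auto simp: iso_def bij_betw_def)
  qed
  then show ?thesis by (simp add: normal_inv_iff simple_socle_subgroup)
qed

section \<open>Solvability, centralisers and the centre\<close>

lemma (in comm_group) solvable_comm_group: "solvable G"
  unfolding solvable_iff_trivial_derived_seq
  using derived_eq_singleton[OF subset_refl] by (intro exI[of _ 1]) simp

text \<open>Needed to see that nilpotent groups are solvable, which makes the Fitting subgroup
  vanish later.\<close>

lemma (in group) derived_series_le_lower_central:
  "(derived G ^^ n) (carrier G) \<subseteq> lower_central G n"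
proof (induction n)
  case (Suc n)
  then have "derived_set G ((derived G ^^ n) (carrier G)) \<subseteq>
      (\<Union>h\<in>lower_central G n. \<Union>g\<in>carrier G. {h \<otimes> g \<otimes> inv h \<otimes> inv g})"
    using exp_of_derived_in_carrier[OF subset_refl, of n] by blast
  then have "derived G ((derived G ^^ n) (carrier G)) \<subseteq> lower_central G (Suc n)"
    unfolding derived_def[of G "(derived G ^^ n) (carrier G)"] lower_central.simps
    by (rule mono_generate)
  then show ?case by simp
qed simp

lemma nilpotent_group_imp_solvable:
  fixes G (structure)
  assumes "nilpotent_group G"
  shows "solvable G"
proof -
  interpret group G using assms by (simp add: nilpotent_group_def)
  obtain n where "lower_central G n = {\<one>}" using assms by (auto simp: nilpotent_group_def)
  then have "(derived G ^^ n) (carrier G) = {\<one>}"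
    using derived_series_le_lower_central[of n]
      subgroup.one_closed[OF exp_of_derived_is_subgroup[OF subgroup_self, of n]] by auto
  then show ?thesis by (auto simp: solvable_iff_trivial_derived_seq)
qed

lemma (in group) centralizer_subgroup:
  assumes "A \<subseteq> carrier G"
  shows "subgroup {x \<in> carrier G. \<forall>y\<in>A. x \<otimes> y = y \<otimes> x} G" (is "subgroup ?C G")
proof (rule subgroupI)
  fix a assume a: "a \<in> ?C"
  have "inv a \<otimes> y = y \<otimes> inv a" if "y \<in> A" for y
  proof -
    have car: "a \<in> carrier G" "y \<in> carrier G" using a that assms by auto
    then have "inv a \<otimes> y = inv a \<otimes> (y \<otimes> a) \<otimes> inv a" by (simp add: m_assoc)
    also have "y \<otimes> a = a \<otimes> y" using a that by simp
    also have "inv a \<otimes> (a \<otimes> y) \<otimes> inv a = y \<otimes> inv a" using car by (simp add: m_assoc)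
    finally show ?thesis .
  qed
  then show "inv a \<in> ?C" using a by simp
next
  fix a b assume ab: "a \<in> ?C" "b \<in> ?C"
  have "a \<otimes> b \<otimes> y = y \<otimes> (a \<otimes> b)" if "y \<in> A" for y
  proof -
    have car: "a \<in> carrier G" "b \<in> carrier G" "y \<in> carrier G" using ab that assms by auto
    then have "a \<otimes> b \<otimes> y = a \<otimes> (b \<otimes> y)" by (rule m_assoc)
    also have "b \<otimes> y = y \<otimes> b" using ab that by simp
    also have "a \<otimes> (y \<otimes> b) = a \<otimes> y \<otimes> b" using car by (simp add: m_assoc)
    also have "a \<otimes> y = y \<otimes> a" using ab that by simp
    also have "y \<otimes> a \<otimes> b = y \<otimes> (a \<otimes> b)" using car by (simp add: m_assoc)
    finally show ?thesis .
  qed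
  then show "a \<otimes> b \<in> ?C" using ab by simp
next
  have "\<one> \<in> ?C" using assms by (simp add: subset_iff)
  then show "?C \<noteq> {}" by blast
qed blast

lemma (in group) centralizer_normal:
  assumes "N \<lhd> G"
  shows "{x \<in> carrier G. \<forall>y\<in>N. x \<otimes> y = y \<otimes> x} \<lhd> G" (is "?C \<lhd> G")
proof -
  interpret N: normal N G by fact
  have "g \<otimes> x \<otimes> inv g \<otimes> y = y \<otimes> (g \<otimes> x \<otimes> inv g)"
    if g: "g \<in> carrier G" and x: "x \<in> ?C" and y: "y \<in> N" for g x y
  proof -
    \<comment> \<open>By normality the conjugate \<open>?z\<close> of \<open>y\<close> is in
      \<open>N\<close>, so \<open>x\<close> commutes with it; conjugating back by \<open>g\<close>
      gives the claim for \<open>y\<close>.\<close>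
    let ?z = "inv g \<otimes> y \<otimes> g"
    have z: "?z \<in> N" by (rule N.inv_op_closed1[OF g y])
    have "g \<otimes> x \<otimes> inv g \<otimes> y = g \<otimes> (x \<otimes> ?z) \<otimes> inv g"
      using g x y by (simp add: m_assoc)
    also have "x \<otimes> ?z = ?z \<otimes> x" using x z by blast
    also have "g \<otimes> (?z \<otimes> x) \<otimes> inv g = y \<otimes> (g \<otimes> x \<otimes> inv g)"
      using g x y by (simp add: m_assoc)
    finally show ?thesis .
  qed
  then show ?thesis
    using centralizer_subgroup[OF N.subset] by (auto simp: normal_inv_iff)
qed

lemma (in group) group_center_normal: "group_center G \<lhd> G"
  using centralizer_normal[OF normal_self] by (simp add: group_center_def)

lemma (in group) comm_subgroup_solvable:
  assumes "subgroup H G" "\<And>x y. x \<in> H \<Longrightarrow> y \<in> H \<Longrightarrow> x \<otimes> y = y \<otimes> x"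
  shows "solvable (G\<lparr>carrier := H\<rparr>)"
proof -
  interpret H: group "G\<lparr>carrier := H\<rparr>" using assms(1) by (rule subgroup_imp_group)
  have "comm_group (G\<lparr>carrier := H\<rparr>)"
    by (rule H.group_comm_groupI) (use assms(2) in simp)
  then show ?thesis by (rule comm_group.solvable_comm_group)
qed

text \<open>The derived subgroup is normal, and if it were trivial the group would be
  solvable.\<close>

lemma (in simple_group) derived_eq_carrier:
  assumes "\<not> solvable G"
  shows "derived G (carrier G) = carrier G"
proof -
  have "(derived G ^^ 1) (carrier G) \<noteq> {\<one>}"
    using assms unfolding solvable_iff_trivial_derived_seq by blast
  then show ?thesis using no_real_normal_subgroup[OF derived_self_is_normal] by simp
qed

text \<open>The centre is an abelian normal subgroup, hence trivial, so the central quotient is the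
  group itself. Perfectness of a simple group follows because it is not solvable.\<close>

lemma (in group) quasisimple_iff_simple:
  assumes no_sol: "\<And>N. N \<lhd> G \<Longrightarrow> solvable (G\<lparr>carrier := N\<rparr>) \<Longrightarrow> N = {\<one>}"
  shows "quasisimple G \<longleftrightarrow> simple_group G"
proof -
  have "solvable (G\<lparr>carrier := group_center G\<rparr>)"
    using normal_imp_subgroup[OF group_center_normal]
    by (rule comm_subgroup_solvable) (unfold group_center_def, blast)
  then have Z: "group_center G = {\<one>}" by (rule no_sol[OF group_center_normal])
  have Mod1: "group (G Mod {\<one>})" by (rule normal.factorgroup_is_group[OF one_is_normal])
  note iso = trivial_factor_iso
  show ?thesis
  proof
    assume "quasisimple G"
    then show "simple_group G"
      using simple_group.iso_simple[OF _ is_group iso] by (simp add: quasisimple_def Z)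
  next
    assume simple: "simple_group G"
    then interpret simple_group G .
    have "\<not> solvable G"
      using no_sol[OF normal_self] simple_not_triv by auto
    then show "quasisimple G"
      using derived_eq_carrier iso_simple[OF Mod1 group.iso_set_sym[OF Mod1 iso]]
      by (simp add: quasisimple_def Z)
  qed
qed

section \<open>Components and F* in the absence of solvable subnormal subgroups\<close>

text \<open>Quantifying over subnormal rather than normal subgroups lets the condition pass to every
  subnormal subgroup, in particular to the components.\<close>

definition no_solvable_subnormal :: "('a, 'm) monoid_scheme \<Rightarrow> bool" where
  "no_solvable_subnormal G \<longleftrightarrow>
     (\<forall>L. subnormal G L \<and> solvable (G\<lparr>carrier := L\<rparr>) \<longrightarrow> L = {\<one>\<^bsub>G\<^esub>})"

lemma (in group) no_solvable_subnormal_not_solvable: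
  assumes "no_solvable_subnormal G" "subnormal G L" "simple_group (G\<lparr>carrier := L\<rparr>)"
  shows "\<not> solvable (G\<lparr>carrier := L\<rparr>)"
  using assms simple_group.simple_not_triv[OF assms(3)] by (auto simp: no_solvable_subnormal_def)

text \<open>Normal subgroups of \<open>L\<close> are subnormal in \<open>G\<close>, so
  \<open>quasisimple_iff_simple\<close> can be applied inside \<open>L\<close>.\<close>

lemma (in group) component_iff_simple:
  assumes "no_solvable_subnormal G"
  shows "component_of_group L G \<longleftrightarrow> subnormal G L \<and> simple_group (G\<lparr>carrier := L\<rparr>)"
proof -
  have "quasisimple (G\<lparr>carrier := L\<rparr>) \<longleftrightarrow> simple_group (G\<lparr>carrier := L\<rparr>)" if L: "subnormal G L"
  proof -
    interpret L: group "G\<lparr>carrier := L\<rparr>"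
      by (rule subgroup_imp_group[OF subnormal_imp_subgroup[OF L]])
    show ?thesis
      using assms subnormal.step[OF L]
      by (intro L.quasisimple_iff_simple) (simp add: no_solvable_subnormal_def)
  qed
  then show ?thesis by (auto simp: component_of_group_def)
qed

text \<open>Nilpotent normal subgroups are solvable, hence trivial; only the layer remains, and its
  components are the simple subnormal subgroups.\<close>

lemma (in group) generalized_Fitting_eq_simple_socle:
  assumes "no_solvable_subnormal G"
  shows "generalized_Fitting G = simple_socle G"
proof -
  have "\<Union>{N. N \<lhd> G \<and> nilpotent_group (G\<lparr>carrier := N\<rparr>)} \<subseteq> {\<one>}"
    using assms normal_imp_subnormal nilpotent_group_imp_solvable
    by (fastforce simp: no_solvable_subnormal_def)
  then have "Fitting G = {\<one>}"
    unfolding Fitting_def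
    using generate_subgroup_incl[OF _ triv_subgroup] by (intro equalityI) (auto intro: generate.one)
  moreover have "layer G = simple_socle G"
    using assms by (simp add: layer_def simple_socle_def component_iff_simple)
  ultimately show ?thesis
    using subgroup.subset[OF simple_socle_subgroup]
    by (simp add: generalized_Fitting_def lcos_mult_one flip: l_coset_eq_set_mult)
qed

section \<open>Centralisers of the socle and of perfect subnormal subgroups\<close>

text \<open>The centraliser is normal, so if nontrivial it contains a simple subnormal
  \<open>L\<close>. This \<open>L\<close> also lies in the socle, hence commutes with itself and is
  solvable, a contradiction.\<close>

lemma (in group) centralizer_simple_socle:
  assumes fin: "finite (carrier G)" and "no_solvable_subnormal G"
    and x: "x \<in> carrier G" "\<And>y. y \<in> simple_socle G \<Longrightarrow> x \<otimes> y = y \<otimes> x"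
  shows "x = \<one>"
proof (rule ccontr)
  assume "x \<noteq> \<one>"
  define C where "C = {x \<in> carrier G. \<forall>y\<in>simple_socle G. x \<otimes> y = y \<otimes> x}"
  have "subnormal G C"
    unfolding C_def by (rule normal_imp_subnormal[OF centralizer_normal[OF simple_socle_normal]])
  moreover have "x \<in> C" using x by (simp add: C_def)
  ultimately obtain L where L: "subnormal G L" "L \<subseteq> C" "simple_group (G\<lparr>carrier := L\<rparr>)"
    using subnormal_contains_simple[OF fin] \<open>x \<noteq> \<one>\<close> by blast
  have "L \<subseteq> simple_socle G" by (rule simple_subnormal_le_socle[OF L(1,3)])
  then have "solvable (G\<lparr>carrier := L\<rparr>)"
    using L(2) by (intro comm_subgroup_solvable subnormal_imp_subgroup[OF L(1)]) (auto simp: C_def)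
  then show False using no_solvable_subnormal_not_solvable[OF assms(2) L(1,3)] by blast
qed

text \<open>The descent step of the three subgroup lemma: \<open>[L, s]\<close> is centralised by \<open>L\<close>, hence
  \<open>[L, L]\<close> commutes with \<open>s\<close>.\<close>

lemma (in group) commutator_commutes:
  assumes L: "subgroup L G" and s: "s \<in> carrier G"
    and c: "\<And>l l'. l \<in> L \<Longrightarrow> l' \<in> L \<Longrightarrow>
      (s \<otimes> l \<otimes> inv s \<otimes> inv l) \<otimes> l' = l' \<otimes> (s \<otimes> l \<otimes> inv s \<otimes> inv l)"
    and d: "\<And>l l'. l \<in> L \<Longrightarrow> l' \<in> L \<Longrightarrow>
      (inv s \<otimes> l \<otimes> s \<otimes> inv l) \<otimes> l' = l' \<otimes> (inv s \<otimes> l \<otimes> s \<otimes> inv l)"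
    and y: "y \<in> derived G L"
  shows "s \<otimes> y = y \<otimes> s"
proof -
  let ?C = "\<lambda>A. {x \<in> carrier G. \<forall>y\<in>A. x \<otimes> y = y \<otimes> x}"
  have LG: "L \<subseteq> carrier G" using L by (rule subgroup.subset)
  have "s \<otimes> k = k \<otimes> s" if k: "k = l \<otimes> l' \<otimes> inv l \<otimes> inv l'" and l: "l \<in> L" "l' \<in> L" for k l l'
  proof -
    define a where "a = s \<otimes> l \<otimes> inv s \<otimes> inv l"
    define b where "b = s \<otimes> l' \<otimes> inv s \<otimes> inv l'"
    have car [simp]: "l \<in> carrier G" "l' \<in> carrier G" "s \<in> carrier G" "a \<in> carrier G" "b \<in> carrier G"
      using l LG s by (auto simp: a_def b_def)
    have a: "a \<in> ?C L" and b: "b \<in> ?C L" using c l by (auto simp: a_def b_def)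
    note CL = centralizer_subgroup[OF LG]
    have "inv a \<in> ?C L" using a by (rule subgroup.m_inv_closed[OF CL])
    then have l': "l' \<in> ?C {inv a}" using l by simp
    \<comment> \<open>As \<open>inv a\<close> is the conjugate by \<open>s\<close> of
      \<open>inv s \<otimes> l \<otimes> s \<otimes> inv l\<close>, hypothesis \<open>d\<close>
      makes it commute with the conjugate of \<open>l'\<close>. It also commutes with
      \<open>l'\<close>, hence with \<open>b\<close>.\<close>
    have "inv a \<otimes> (s \<otimes> l' \<otimes> inv s) = s \<otimes> ((inv s \<otimes> l \<otimes> s \<otimes> inv l) \<otimes> l') \<otimes> inv s"
      by (simp add: a_def m_assoc inv_mult_group)
    also have "\<dots> = s \<otimes> (l' \<otimes> (inv s \<otimes> l \<otimes> s \<otimes> inv l)) \<otimes> inv s"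
      using d l by simp
    also have "\<dots> = (s \<otimes> l' \<otimes> inv s) \<otimes> inv a"
      by (simp add: a_def m_assoc inv_mult_group)
    finally have "s \<otimes> l' \<otimes> inv s \<in> ?C {inv a}" by simp
    moreover have Ca: "subgroup (?C {inv a}) G" by (rule centralizer_subgroup) simp
    ultimately have "b \<in> ?C {inv a}"
      unfolding b_def using subgroup.m_closed[OF Ca _ subgroup.m_inv_closed[OF Ca l']] by blast
    then have "inv a \<in> ?C {b}" by simp
    moreover have "subgroup (?C {b}) G" by (rule centralizer_subgroup) simp
    ultimately have "inv (inv a) \<in> ?C {b}" by (rule subgroup.m_inv_closed[rotated])
    then have ab: "a \<otimes> b = b \<otimes> a" by simp
    \<comment> \<open>Conjugation by \<open>s\<close> multiplies \<open>l\<close> and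
      \<open>l'\<close> by \<open>a\<close> and \<open>b\<close>, which centralise \<open>L\<close>
      and commute with each other. So it sends \<open>k\<close> to the conjugate of \<open>k\<close>
      by \<open>a \<otimes> b\<close>, which is \<open>k\<close>.\<close>
    have al: "s \<otimes> l \<otimes> inv s = a \<otimes> l" and bl: "s \<otimes> l' \<otimes> inv s = b \<otimes> l'"
      by (simp_all add: a_def b_def m_assoc)
    have "(a \<otimes> l) \<otimes> (b \<otimes> l') = a \<otimes> (l \<otimes> b) \<otimes> l'" by (simp add: m_assoc)
    also have "l \<otimes> b = b \<otimes> l" using b l by simp
    also have "a \<otimes> (b \<otimes> l) \<otimes> l' = (a \<otimes> b) \<otimes> (l \<otimes> l')" by (simp add: m_assoc)
    finally have xy: "(a \<otimes> l) \<otimes> (b \<otimes> l') = (a \<otimes> b) \<otimes> (l \<otimes> l')" .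
    have "(b \<otimes> l') \<otimes> (a \<otimes> l) = b \<otimes> (l' \<otimes> a) \<otimes> l" by (simp add: m_assoc)
    also have "l' \<otimes> a = a \<otimes> l'" using a l by simp
    also have "b \<otimes> (a \<otimes> l') \<otimes> l = (b \<otimes> a) \<otimes> (l' \<otimes> l)" by (simp add: m_assoc)
    finally have yx: "(b \<otimes> l') \<otimes> (a \<otimes> l) = (a \<otimes> b) \<otimes> (l' \<otimes> l)" by (simp add: ab)
    have kL: "k \<in> L" using l L unfolding k by (intro subgroup.m_closed subgroup.m_inv_closed)
    have "a \<otimes> b \<in> ?C L" using a b by (rule subgroup.m_closed[OF CL])
    then have abk: "a \<otimes> b \<otimes> k = k \<otimes> (a \<otimes> b)" using kL by simp
    have "s \<otimes> k \<otimes> inv s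
        = (s \<otimes> l \<otimes> inv s) \<otimes> (s \<otimes> l' \<otimes> inv s) \<otimes> inv ((s \<otimes> l' \<otimes> inv s) \<otimes> (s \<otimes> l \<otimes> inv s))"
      by (simp add: k m_assoc inv_mult_group)
    also have "\<dots> = (a \<otimes> b) \<otimes> (l \<otimes> l') \<otimes> inv ((a \<otimes> b) \<otimes> (l' \<otimes> l))"
      by (simp only: al bl xy yx)
    also have "\<dots> = a \<otimes> b \<otimes> k \<otimes> inv (a \<otimes> b)"
      by (simp add: k m_assoc inv_mult_group)
    also have "\<dots> = k" unfolding abk using kL LG by (simp add: m_assoc subset_iff)
    finally have "s \<otimes> k \<otimes> inv s \<otimes> s = k \<otimes> s" by simp
    then show ?thesis using kL LG by (simp add: m_assoc subset_iff)
  qed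
  then have "derived_set G L \<subseteq> ?C {s}" using LG L s
    by (auto intro!: subgroup.m_closed subgroup.m_inv_closed subgroup_self)
  then have "derived G L \<subseteq> ?C {s}"
    unfolding derived_def using s by (intro generate_subgroup_incl centralizer_subgroup) auto
  then show ?thesis using y by auto
qed

text \<open>The induction climbs the chain from \<open>K\<close> up to \<open>G\<close>. If
  \<open>H\<close> is normal in \<open>K\<close> and contains \<open>L\<close>, commutators of
  \<open>N \<inter> K\<close> with \<open>L\<close> fall into \<open>N \<inter> H\<close>, which
  commutes with \<open>L\<close>; by \<open>commutator_commutes\<close> and perfectness,
  \<open>N \<inter> K\<close> then commutes with \<open>L\<close>.\<close>

lemma (in group) perfect_subnormal_centralizes:
  assumes N: "N \<lhd> G" and L: "subgroup L G" "derived G L = L"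
    and K: "subnormal G K" "L \<subseteq> K"
    and comm: "\<And>s l. s \<in> N \<inter> K \<Longrightarrow> l \<in> L \<Longrightarrow> s \<otimes> l = l \<otimes> s"
    and sl: "s \<in> N" "l \<in> L"
  shows "s \<otimes> l = l \<otimes> s"
  using K comm sl
proof (induction arbitrary: s l rule: subnormal.induct)
  case self
  then show ?case using subgroup.subset[OF normal_imp_subgroup[OF N]] by blast
next
  case (step K H)
  interpret N: normal N G by (rule N)
  have K: "subgroup K G" by (rule subnormal_imp_subgroup[OF step.hyps(1)])
  have H: "subgroup H G" "H \<subseteq> K" "\<And>k h. k \<in> K \<Longrightarrow> h \<in> H \<Longrightarrow> k \<otimes> h \<otimes> inv k \<in> H"
    using step.hyps(2) K by (auto simp: normal_in_subgroup_iff)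
  have LG: "L \<subseteq> carrier G" using L(1) by (rule subgroup.subset)
  have comm_in: "t \<otimes> l \<otimes> inv t \<otimes> inv l \<in> N \<inter> H" if t: "t \<in> N \<inter> K" and l: "l \<in> L" for t l
  proof -
    have "t \<otimes> l \<otimes> inv t \<in> H" using H(3) t l step.prems(1) by blast
    moreover have "inv l \<in> H" using l step.prems(1) H(1) by (blast intro: subgroup.m_inv_closed)
    ultimately have "t \<otimes> l \<otimes> inv t \<otimes> inv l \<in> H" using H(1) by (blast intro: subgroup.m_closed)
    moreover have "t \<otimes> (l \<otimes> inv t \<otimes> inv l) \<in> N"
      using t l LG by (blast intro: N.inv_op_closed2)
    then have "t \<otimes> l \<otimes> inv t \<otimes> inv l \<in> N" using t l LG by (simp add: m_assoc subset_iff)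
    ultimately show ?thesis by blast
  qed
  have "t \<otimes> m = m \<otimes> t" if t: "t \<in> N \<inter> K" and m: "m \<in> L" for t m
  proof (rule commutator_commutes[OF L(1)])
    have it: "inv t \<in> N \<inter> K" using t K by (auto intro: subgroup.m_inv_closed)
    show tG: "t \<in> carrier G" using t by simp
    show "m \<in> derived G L" using m L(2) by simp
    fix l l' assume l: "l \<in> L" "l' \<in> L"
    show "(t \<otimes> l \<otimes> inv t \<otimes> inv l) \<otimes> l' = l' \<otimes> (t \<otimes> l \<otimes> inv t \<otimes> inv l)"
      by (rule step.prems(2)[OF comm_in[OF t l(1)] l(2)])
    show "(inv t \<otimes> l \<otimes> t \<otimes> inv l) \<otimes> l' = l' \<otimes> (inv t \<otimes> l \<otimes> t \<otimes> inv l)"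
      using step.prems(2)[OF comm_in[OF it l(1)] l(2)] tG by simp
  qed
  moreover have "L \<subseteq> K" using step.prems(1) H(2) by blast
  ultimately show ?case using step.IH step.prems(3,4) by blast
qed

text \<open>A simple subnormal \<open>L\<close> of \<open>M\<close> outside the socle
  \<open>S\<close> of \<open>G\<close> meets \<open>S\<close> trivially and is perfect. By
  \<open>perfect_subnormal_centralizes\<close>, with \<open>L\<close> itself as the chain's end, it
  centralises \<open>S\<close>, which is impossible.\<close>

lemma (in group) simple_socle_subgroup_eq:
  assumes fin: "finite (carrier G)" and M: "subgroup M G" "simple_socle G \<subseteq> M"
    and ns: "no_solvable_subnormal G" "no_solvable_subnormal (G\<lparr>carrier := M\<rparr>)"
  shows "simple_socle (G\<lparr>carrier := M\<rparr>) = simple_socle G"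
proof
  interpret M: group "G\<lparr>carrier := M\<rparr>" using M(1) by (rule subgroup_imp_group)
  let ?S = "simple_socle G"
  have SM: "?S \<lhd> G\<lparr>carrier := M\<rparr>"
    by (rule normal_restrict_supergroup[OF M(1) simple_socle_normal M(2)])
  have "L \<subseteq> simple_socle (G\<lparr>carrier := M\<rparr>)"
    if L: "subnormal G L" "simple_group (G\<lparr>carrier := L\<rparr>)" for L
  proof (rule M.simple_subnormal_le_socle)
    show "subnormal (G\<lparr>carrier := M\<rparr>) L"
      using subnormal_restrict[OF L(1) M(1)] simple_subnormal_le_socle[OF L] M(2) by blast
  qed (use L in simp)
  then show "?S \<subseteq> simple_socle (G\<lparr>carrier := M\<rparr>)"
    unfolding simple_socle_def[of G]
    by (intro generate_subgroup_incl incl_subgroup[OF M(1) M.simple_socle_subgroup]) blast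
  have "L \<subseteq> ?S"
    if L: "subnormal (G\<lparr>carrier := M\<rparr>) L" "simple_group (G\<lparr>carrier := M, carrier := L\<rparr>)" for L
  proof (rule ccontr)
    assume nle: "\<not> L \<subseteq> ?S"
    interpret L: simple_group "G\<lparr>carrier := L\<rparr>" using L(2) by simp
    have LM: "subgroup L (G\<lparr>carrier := M\<rparr>)" by (rule M.subnormal_imp_subgroup[OF L(1)])
    then have LG: "subgroup L G" "L \<subseteq> M" using incl_subgroup[OF M(1)] subgroup.subset by fastforce+
    have "?S \<inter> L \<lhd> G\<lparr>carrier := L\<rparr>"
      using M.normal_Int_subgroup[OF LM SM] by simp
    then have SL: "?S \<inter> L = {\<one>}" using L.no_real_normal_subgroup nle by fastforce
    have "\<not> solvable (G\<lparr>carrier := L\<rparr>)"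
      using M.no_solvable_subnormal_not_solvable[OF ns(2) L] by simp
    then have "derived (G\<lparr>carrier := L\<rparr>) L = L" using L.derived_eq_carrier by simp
    then have "derived (G\<lparr>carrier := M\<rparr>) L = L"
      using derived_consistent[OF subset_refl LG(1)] derived_consistent[OF LG(2) M(1)] by simp
    then have comm: "s \<otimes> l = l \<otimes> s" if "s \<in> ?S" "l \<in> L" for s l
      using M.perfect_subnormal_centralizes[OF SM LM _ L(1) subset_refl _ that] SL
        subgroup.mem_carrier[OF LG(1)] by simp
    have "l = \<one>" if "l \<in> L" for l
      using centralizer_simple_socle[OF fin ns(1)] comm that subgroup.mem_carrier[OF LG(1)] by metis
    then have "L = {\<one>}" using subgroup.one_closed[OF LG(1)] by blast
    then show False using L.simple_not_triv by simp
  qed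
  then show "simple_socle (G\<lparr>carrier := M\<rparr>) \<subseteq> ?S"
    unfolding simple_socle_def[of "G\<lparr>carrier := M\<rparr>"]
    by (intro M.generate_subgroup_incl normal_imp_subgroup[OF SM]) blast
qed

section \<open>Functorials relative to a normal subgroup\<close>

text \<open>\<open>Y\<close> is any model of the quotient of \<open>G\<close> by \<open>N\<close>.
  This freedom matters because functorials are evaluated only at groups on natural numbers.\<close>

definition quotient_map ::
    "('a, 'm) monoid_scheme \<Rightarrow> 'a set \<Rightarrow> ('b, 'n) monoid_scheme \<Rightarrow> ('a \<Rightarrow> 'b) \<Rightarrow> bool" where
  "quotient_map G N Y q \<longleftrightarrow>
     group G \<and> finite (carrier G) \<and> group Y \<and> q \<in> epi G Y \<and> N = {x \<in> carrier G. q x = \<one>\<^bsub>Y\<^esub>}"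

lemma quotient_mapD:
  assumes "quotient_map G N Y q"
  shows "group G" "finite (carrier G)" "group Y" "finite (carrier Y)" "group_hom G Y q"
    "q ` carrier G = carrier Y" "N = {x \<in> carrier G. q x = \<one>\<^bsub>Y\<^esub>}" "kernel G Y q = N"
proof -
  show *: "group G" "finite (carrier G)" "group Y" "q ` carrier G = carrier Y"
    "N = {x \<in> carrier G. q x = \<one>\<^bsub>Y\<^esub>}" "kernel G Y q = N"
    using assms by (auto simp: quotient_map_def epi_def kernel_def)
  show "finite (carrier Y)" using *(2,4) by (metis finite_imageI)
  show "group_hom G Y q"
    using assms by (simp add: quotient_map_def group_hom_def group_hom_axioms_def epi_def)
qed

lemma quotient_map_normal: "quotient_map G N Y q \<Longrightarrow> N \<lhd> G"
  using group_hom.normal_kernel quotient_mapD(5,8) by metis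

lemma quotient_map_Mod:
  fixes G (structure)
  assumes "group G" "finite (carrier G)" "N \<lhd> G"
  shows "quotient_map G N (G Mod N) (\<lambda>x. N #> x)"
proof -
  interpret normal N G by fact
  have "N #> x = N \<longleftrightarrow> x \<in> N" if "x \<in> carrier G" for x
    using that coset_join1[OF _ that subgroup_axioms] coset_join2[OF that subgroup_axioms] by blast
  then show ?thesis
    using assms r_coset_hom_Mod factorgroup_is_group subset
    by (auto simp: quotient_map_def epi_def carrier_FactGroup)
qed

lemma quotient_map_iso:
  assumes "group G" "finite (carrier G)" "group Y" "f \<in> iso G Y"
  shows "quotient_map G {\<one>\<^bsub>G\<^esub>} Y f"
proof -
  have "kernel G Y f = {\<one>\<^bsub>G\<^esub>}" using assms by (simp add: iso_kernel_image)
  then show ?thesis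
    using assms by (auto simp: quotient_map_def iso_iff_mon_epi kernel_def)
qed

lemma quotient_map_comp:
  assumes "quotient_map G N Y q" "quotient_map Y K Z r"
  shows "quotient_map G {x \<in> carrier G. q x \<in> K} Z (r \<circ> q)"
  using assms epi_compose[of q G Y r Z] hom_in_carrier[of q G Y]
  by (auto simp: quotient_map_def epi_def)

text \<open>The coset map followed by a renaming of the cosets as natural numbers.\<close>

lemma quotient_map_nat:
  assumes "group G" "finite (carrier G)" "N \<lhd> G"
  obtains H :: "nat monoid" and q where "quotient_map G N H q"
proof -
  have fin: "finite (carrier (G Mod N))" using assms(2) by (simp add: carrier_FactGroup)
  have G: "group (G Mod N)" by (rule normal.factorgroup_is_group[OF assms(3)])
  obtain H :: "nat monoid" and f where H: "group H" "f \<in> iso (G Mod N) H"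
    using finite_group_iso_nat[OF G fin] by metis
  have "quotient_map G {x \<in> carrier G. N #>\<^bsub>G\<^esub> x \<in> {\<one>\<^bsub>G Mod N\<^esub>}} H (f \<circ> (\<lambda>x. N #>\<^bsub>G\<^esub> x))"
    by (rule quotient_map_comp[OF quotient_map_Mod[OF assms] quotient_map_iso[OF G fin H]])
  also have "{x \<in> carrier G. N #>\<^bsub>G\<^esub> x \<in> {\<one>\<^bsub>G Mod N\<^esub>}} = N"
    using quotient_mapD(7)[OF quotient_map_Mod[OF assms]] by simp
  finally show ?thesis by (rule that)
qed

lemma quotient_map_eq_iff:
  assumes "quotient_map G N Y q" "x \<in> carrier G" "y \<in> carrier G"
  shows "q x = q y \<longleftrightarrow> x \<otimes>\<^bsub>G\<^esub> inv\<^bsub>G\<^esub> y \<in> N"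
proof -
  interpret q: group_hom G Y q by (rule quotient_mapD(5)[OF assms(1)])
  have "q x \<otimes>\<^bsub>Y\<^esub> inv\<^bsub>Y\<^esub> q y = \<one>\<^bsub>Y\<^esub> \<longleftrightarrow> q x = q y"
    using assms(2,3) q.H.inv_solve_right' by (metis q.H.l_one q.H.one_closed q.hom_closed)
  then show ?thesis using assms by (auto simp: quotient_mapD(7)[OF assms(1)])
qed

lemma quotient_map_factor:
  assumes q: "quotient_map G N Y q" and h: "group_hom G Z h"
    and N: "\<And>x. x \<in> N \<Longrightarrow> h x = \<one>\<^bsub>Z\<^esub>"
  obtains e where "e \<in> hom Y Z" "\<And>x. x \<in> carrier G \<Longrightarrow> e (q x) = h x"
proof -
  interpret q: group_hom G Y q by (rule quotient_mapD(5)[OF q])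
  interpret h: group_hom G Z h by (rule h)
  note surj = quotient_mapD(6)[OF q]
  \<comment> \<open>The value is read off an arbitrary preimage; two preimages differ by an element
    of \<open>N\<close>, which \<open>h\<close> sends to the identity.\<close>
  define e where "e y = h (SOME x. x \<in> carrier G \<and> q x = y)" for y
  have e: "e (q x) = h x" if x: "x \<in> carrier G" for x
  proof -
    define x' where "x' = (SOME x'. x' \<in> carrier G \<and> q x' = q x)"
    have x': "x' \<in> carrier G" "q x' = q x"
      using someI[of "\<lambda>x'. x' \<in> carrier G \<and> q x' = q x" x] x by (simp_all add: x'_def)
    then have "x' \<otimes>\<^bsub>G\<^esub> inv\<^bsub>G\<^esub> x \<in> N" using quotient_map_eq_iff[OF q] x by blast
    then have "h x' \<otimes>\<^bsub>Z\<^esub> inv\<^bsub>Z\<^esub> h x = \<one>\<^bsub>Z\<^esub>" using N x x' by fastforce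
    then have "h x' = h x"
      using x x' h.H.inv_solve_right' by (metis h.H.l_one h.H.one_closed h.hom_closed)
    then show ?thesis by (simp add: e_def x'_def)
  qed
  have "e \<in> hom Y Z"
  proof (rule homI)
    fix y assume "y \<in> carrier Y"
    then show "e y \<in> carrier Z" using surj e by (metis h.hom_closed imageE)
  next
    fix y y' assume "y \<in> carrier Y" "y' \<in> carrier Y"
    then obtain x x' where "x \<in> carrier G" "y = q x" "x' \<in> carrier G" "y' = q x'"
      using surj by (metis imageE)
    then show "e (y \<otimes>\<^bsub>Y\<^esub> y') = e y \<otimes>\<^bsub>Z\<^esub> e y'"
      using e by (metis h.hom_mult q.hom_mult q.G.m_closed)
  qed
  then show ?thesis using that e by blast
qed

lemma (in group_hom) normal_preimage:
  assumes "K \<lhd> H"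
  shows "{x \<in> carrier G. h x \<in> K} \<lhd> G"
proof -
  interpret K: normal K H by fact
  have "subgroup {x \<in> carrier G. h x \<in> K} G"
    by (rule G.subgroupI) (auto intro!: exI[of _ \<one>])
  then show ?thesis
    using K.inv_op_closed2 by (auto simp: G.normal_inv_iff)
qed

section \<open>Values at quotients, pulled back to the group\<close>

text \<open>The construction common to \<open>upper_product\<close> and
  \<open>functorial_series\<close>, isolated so that different functorials can be interleaved over a
  group of any type.\<close>

definition functorial_step :: "group_functional \<Rightarrow> ('a, 'm) monoid_scheme \<Rightarrow> 'a set \<Rightarrow> 'a set" where
  "functorial_step \<tau> G N = {x \<in> carrier G. N #>\<^bsub>G\<^esub> x \<in> functorial_at \<tau> (G Mod N)}"

text \<open>Condition (P1) on its own, to be shared by \<open>\<rho>\<close> and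
  \<open>simple_socle\<close>.\<close>

definition preserved_by_epi :: "group_functional \<Rightarrow> bool" where
  "preserved_by_epi \<tau> \<longleftrightarrow>
     (\<forall>G H f. group G \<and> finite (carrier G) \<and> group H \<and> f \<in> epi G H \<longrightarrow> f ` \<tau> G \<subseteq> \<tau> H)"

lemma functorial_at_iff:
  fixes H :: "nat monoid"
  assumes "functorial \<tau>" "group G" "finite (carrier G)" "group H" "f \<in> iso G H" "x \<in> carrier G"
  shows "x \<in> functorial_at \<tau> G \<longleftrightarrow> f x \<in> \<tau> H"
proof -
  have "inj_on f (carrier G)" using assms(5) by (simp add: iso_def bij_betw_def)
  moreover have "functorial_at \<tau> G \<subseteq> carrier G" by (auto simp: functorial_at_def)
  ultimately show ?thesis
    using functorial_at_iso_nat[OF assms(1-5)] assms(6) by (metis inj_on_image_mem_iff)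
qed

text \<open>The isomorphism from \<open>G Mod N\<close> to \<open>H\<close> induced by
  \<open>q\<close> sends the coset of \<open>x\<close> to \<open>q x\<close>, so any model of the
  quotient computes the step.\<close>

lemma functorial_step_eq:
  fixes H :: "nat monoid"
  assumes "functorial \<tau>" and q: "quotient_map G N H q"
  shows "functorial_step \<tau> G N = {x \<in> carrier G. q x \<in> \<tau> H}"
proof -
  note Q = quotient_mapD[OF q]
  interpret q: group_hom G H q by (rule Q(5))
  let ?f = "\<lambda>A. the_elem (q ` A)"
  have iso: "?f \<in> iso (G Mod N) H" using q.FactGroup_iso_set[OF Q(6)] Q(8) by simp
  have N: "N \<lhd> G" by (rule quotient_map_normal[OF q])
  have fin: "finite (carrier (G Mod N))" using Q(2) by (simp add: carrier_FactGroup)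
  have "N #>\<^bsub>G\<^esub> x \<in> functorial_at \<tau> (G Mod N) \<longleftrightarrow> q x \<in> \<tau> H" if x: "x \<in> carrier G" for x
  proof -
    have "x \<in> N #>\<^bsub>G\<^esub> x" using q.G.rcos_self[OF x normal_imp_subgroup[OF N]] .
    moreover have "q y = q x" if "y \<in> N #>\<^bsub>G\<^esub> x" for y
      using that x by (auto simp: r_coset_def Q(7))
    ultimately have "q ` (N #>\<^bsub>G\<^esub> x) = {q x}" by blast
    moreover have "N #>\<^bsub>G\<^esub> x \<in> carrier (G Mod N)" using x by (simp add: carrier_FactGroup)
    ultimately show ?thesis
      using functorial_at_iff[OF assms(1) normal.factorgroup_is_group[OF N] fin Q(3) iso] by simp
  qed
  then show ?thesis by (auto simp: functorial_step_def)
qed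

lemma functorial_normal:
  fixes H :: "nat monoid"
  assumes "functorial \<tau>" "group H" "finite (carrier H)"
  shows "\<tau> H \<lhd> H"
proof -
  interpret group H by fact
  have "g \<otimes>\<^bsub>H\<^esub> x \<otimes>\<^bsub>H\<^esub> inv\<^bsub>H\<^esub> g \<in> \<tau> H" if "g \<in> carrier H" "x \<in> \<tau> H" for g x
    using assms conjugation_iso[OF that(1)] that(2) unfolding functorial_def by blast
  then show ?thesis using assms by (auto simp: functorial_def normal_inv_iff)
qed

context
  fixes \<tau> :: group_functional
  assumes functorial: "functorial \<tau>"
begin

lemma functorial_step_normal:
  assumes "group G" "finite (carrier G)" "N \<lhd> G"
  shows "functorial_step \<tau> G N \<lhd> G"
proof -
  obtain H :: "nat monoid" and q where q: "quotient_map G N H q"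
    using quotient_map_nat[OF assms] .
  note Q = quotient_mapD[OF q]
  show ?thesis
    unfolding functorial_step_eq[OF functorial q]
    by (rule group_hom.normal_preimage[OF Q(5) functorial_normal[OF functorial Q(3,4)]])
qed

lemma functorial_step_increasing:
  assumes "group G" "finite (carrier G)" "N \<lhd> G"
  shows "N \<subseteq> functorial_step \<tau> G N"
proof -
  obtain H :: "nat monoid" and q where q: "quotient_map G N H q"
    using quotient_map_nat[OF assms] .
  note Q = quotient_mapD[OF q]
  have "\<one>\<^bsub>H\<^esub> \<in> \<tau> H"
    using functorial_normal[OF functorial Q(3,4)] normal_imp_subgroup subgroup.one_closed by blast
  then show ?thesis unfolding functorial_step_eq[OF functorial q] by (auto simp: Q(7))
qed

text \<open>A quotient map of \<open>Y\<close> modulo \<open>K\<close>, composed with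
  \<open>q\<close>, has the preimage of \<open>K\<close> as kernel; one model of the quotient
  therefore computes both sides.\<close>

lemma functorial_step_preimage:
  assumes q: "quotient_map G N Y q" and K: "K \<lhd> Y"
  shows "functorial_step \<tau> G {x \<in> carrier G. q x \<in> K} = {x \<in> carrier G. q x \<in> functorial_step \<tau> Y K}"
proof -
  note Q = quotient_mapD[OF q]
  obtain H :: "nat monoid" and r where r: "quotient_map Y K H r"
    using quotient_map_nat[OF Q(3,4) K] .
  have "q x \<in> carrier Y" if "x \<in> carrier G" for x using Q(6) that by blast
  then show ?thesis
    by (auto simp: functorial_step_eq[OF functorial r]
        functorial_step_eq[OF functorial quotient_map_comp[OF q r]])
qed

lemma functorial_step_one:
  fixes H :: "nat monoid"
  assumes "group H" "finite (carrier H)"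
  shows "functorial_step \<tau> H {\<one>\<^bsub>H\<^esub>} = \<tau> H"
proof -
  have "\<tau> H \<subseteq> carrier H"
    using functorial_normal[OF functorial assms] normal_imp_subgroup subgroup.subset by blast
  then show ?thesis
    using functorial_step_eq[OF functorial quotient_map_iso[OF assms assms(1) iso_set_refl]] by auto
qed

text \<open>Since \<open>N\<close> lies in \<open>K\<close> and every coset of \<open>K\<close>
  meets \<open>M\<close>, the quotient of \<open>M\<close> by \<open>N\<close> maps onto that of
  \<open>G\<close> by \<open>K\<close>, and \<open>\<tau>\<close> is compatible with this
  epimorphism.\<close>

lemma functorial_step_mono:
  fixes G (structure)
  assumes epi: "preserved_by_epi \<tau>"
    and G: "group G" "finite (carrier G)" and M: "subgroup M G" and N: "N \<lhd> G\<lparr>carrier := M\<rparr>"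
    and K: "K \<lhd> G" and "N \<subseteq> K" "carrier G \<subseteq> K <#> M"
  shows "functorial_step \<tau> (G\<lparr>carrier := M\<rparr>) N \<subseteq> functorial_step \<tau> G K"
proof -
  let ?M = "G\<lparr>carrier := M\<rparr>"
  have MG: "M \<subseteq> carrier G" using M by (rule subgroup.subset)
  have fM: "group ?M" "finite (carrier ?M)"
    using group.subgroup_imp_group[OF G(1) M] finite_subset[OF MG G(2)] by auto
  obtain H :: "nat monoid" and q where q: "quotient_map G K H q"
    using quotient_map_nat[OF G K] .
  obtain H' :: "nat monoid" and r where r: "quotient_map ?M N H' r"
    using quotient_map_nat[OF fM N] .
  note Q = quotient_mapD[OF q] and R = quotient_mapD[OF r]
  interpret q: group_hom G H q by (rule Q(5))
  have "q \<in> hom ?M H" using MG by (intro homI) (auto simp: subset_iff)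
  then have "group_hom ?M H q"
    using fM Q(3) by (simp add: group_hom_def group_hom_axioms_def)
  moreover have "q x = \<one>\<^bsub>H\<^esub>" if "x \<in> N" for x using that \<open>N \<subseteq> K\<close> Q(7) by blast
  ultimately obtain e where e: "e \<in> hom H' H" "\<And>x. x \<in> M \<Longrightarrow> e (r x) = q x"
    using quotient_map_factor[OF r] by (metis partial_object.select_convs(1)
      partial_object.surjective partial_object.update_convs(1))
  have "carrier H \<subseteq> e ` carrier H'"
  proof
    fix y assume "y \<in> carrier H"
    then obtain g where g: "g \<in> carrier G" "y = q g" using Q(6) by blast
    then obtain k m where km: "k \<in> K" "m \<in> M" "g = k \<otimes> m"
      using assms(8) by (auto simp: set_mult_def)
    \<comment> \<open>The factor \<open>k\<close> lies in the kernel of \<open>q\<close>, so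
      \<open>g\<close> and \<open>m\<close> have the same image.\<close>
    have "y = q m" using g km MG by (auto simp: Q(7))
    also have "\<dots> = e (r m)" using e(2) km(2) by simp
    finally show "y \<in> e ` carrier H'" using R(6) km(2) by auto
  qed
  then have "e \<in> epi H' H" using e(1) by (simp add: epi_iff_subset)
  then have "e ` \<tau> H' \<subseteq> \<tau> H" using epi R(3,4) Q(3) by (simp add: preserved_by_epi_def)
  then show ?thesis
    using MG e(2) unfolding functorial_step_eq[OF functorial q] functorial_step_eq[OF functorial r]
    by force
qed

end

text \<open>Serves for upper products, whose functoriality is not established separately: agreement
  is demanded at every isomorphic copy on natural numbers, and such a copy exists.\<close>

lemma functorial_at_eqI:
  assumes "group Y" "finite (carrier Y)" "A \<subseteq> carrier Y"
    and "\<And>(H :: nat monoid) f y. group H \<Longrightarrow> finite (carrier H) \<Longrightarrow> f \<in> iso Y H \<Longrightarrow> y \<in> carrier Y \<Longrightarrow>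
      f y \<in> \<delta> H \<longleftrightarrow> y \<in> A"
  shows "functorial_at \<delta> Y = A"
proof -
  obtain H :: "nat monoid" and f where H: "group H" "finite (carrier H)" "f \<in> iso Y H"
    using finite_group_iso_nat[OF assms(1,2)] .
  have "finite (carrier K)" if "g \<in> iso Y K" for K :: "nat monoid" and g
    using that assms(2) bij_betw_finite by (auto simp: iso_def)
  then show ?thesis using assms(3,4) H unfolding functorial_at_def by blast
qed

section \<open>The socle as a functorial\<close>

lemma preserved_by_epi_simple_socle: "preserved_by_epi simple_socle"
  unfolding preserved_by_epi_def
proof (intro allI impI)
  fix G H :: "nat monoid" and f
  assume A: "group G \<and> finite (carrier G) \<and> group H \<and> f \<in> epi G H"
  then interpret group_hom G H f by (simp add: group_hom_def group_hom_axioms_def epi_def)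
  show "f ` simple_socle G \<subseteq> simple_socle H"
    using A by (intro simple_socle_image) (simp add: epi_def)
qed

text \<open>The inclusion for epimorphisms, used for \<open>f\<close> and for its inverse, yields
  equality.\<close>

lemma functorial_simple_socle: "functorial simple_socle"
  unfolding functorial_def
proof (intro conjI allI impI)
  fix G :: "nat monoid" assume "group G \<and> finite (carrier G)"
  then show "subgroup (simple_socle G) G" using group.simple_socle_subgroup by blast
next
  fix G H :: "nat monoid" and f
  assume A: "group G \<and> finite (carrier G) \<and> group H \<and> f \<in> iso G H"
  let ?g = "inv_into (carrier G) f"
  have f: "f ` carrier G = carrier H" "f \<in> epi G H"
    using A by (auto simp: iso_iff_mon_epi epi_def)
  have "finite (carrier H)" using A f(1) by (metis finite_imageI)
  have g: "?g \<in> epi H G" using A group.iso_set_sym by (auto simp: iso_iff_mon_epi)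
  have "?g ` simple_socle H \<subseteq> simple_socle G"
    using preserved_by_epi_simple_socle A \<open>finite (carrier H)\<close> g unfolding preserved_by_epi_def by blast
  then have "f ` ?g ` simple_socle H \<subseteq> f ` simple_socle G" by (rule image_mono)
  moreover have "f ` ?g ` simple_socle H = simple_socle H"
    using f(1) A group.simple_socle_subgroup subgroup.subset by (metis image_inv_into_cancel)
  moreover have "f ` simple_socle G \<subseteq> simple_socle H"
    using preserved_by_epi_simple_socle A f unfolding preserved_by_epi_def by blast
  ultimately show "f ` simple_socle G = simple_socle H" by blast
qed

lemma functorial_step_mono_normal:
  assumes \<tau>: "functorial \<tau>" "preserved_by_epi \<tau>"
    and G: "group G" "finite (carrier G)" and NK: "N \<lhd> G" "K \<lhd> G" "N \<subseteq> K"
  shows "functorial_step \<tau> G N \<subseteq> functorial_step \<tau> G K"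
proof -
  interpret K: normal K G by (rule NK(2))
  \<comment> \<open>This is the case of \<open>functorial_step_mono\<close> in which the subgroup is
    the whole group.\<close>
  have "{\<one>\<^bsub>G\<^esub>} <#>\<^bsub>G\<^esub> carrier G \<subseteq> K <#>\<^bsub>G\<^esub> carrier G"
    by (rule mono_set_mult) (simp_all add: K.one_closed)
  then have "carrier G \<subseteq> K <#>\<^bsub>G\<^esub> carrier G"
    by (simp add: K.lcos_mult_one flip: l_coset_eq_set_mult)
  then show ?thesis
    using functorial_step_mono[OF \<tau>(1,2) G group.subgroup_self[OF G(1)] _ NK(2,3)] NK(1) by simp
qed

lemma quotient_map_restrict:
  assumes q: "quotient_map G N Y q" and M: "subgroup M G" "N \<subseteq> M"
  shows "quotient_map (G\<lparr>carrier := M\<rparr>) N (Y\<lparr>carrier := q ` M\<rparr>) q"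
proof -
  note Q = quotient_mapD[OF q]
  interpret q: group_hom "G\<lparr>carrier := M\<rparr>" "Y\<lparr>carrier := q ` M\<rparr>" q
    by (rule group_hom.induced_group_hom[OF Q(5) M(1)])
  have MG: "M \<subseteq> carrier G" using M(1) by (rule subgroup.subset)
  then have "N = {x \<in> M. q x = \<one>\<^bsub>Y\<^esub>}" using Q(7) M(2) by blast
  moreover have "finite M" using MG Q(2) by (rule finite_subset)
  ultimately show ?thesis
    using q.G.is_group q.H.is_group q.homh by (simp add: quotient_map_def epi_def)
qed

section \<open>The alternating series of a radical containing the soluble radical\<close>

locale radical_containing_solvable =
  fixes \<rho> :: group_functional
  assumes Kurosh_Amitsur: "hereditary_Kurosh_Amitsur_radical \<rho>"
    and soluble_radical_le: "\<And>H :: nat monoid. group H \<Longrightarrow> finite (carrier H) \<Longrightarrow> soluble_radical H \<subseteq> \<rho> H"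
begin

lemma functorial_\<rho>: "functorial \<rho>" and preserved_by_epi_\<rho>: "preserved_by_epi \<rho>"
  and hereditary_\<rho>: "group G \<Longrightarrow> finite (carrier G) \<Longrightarrow> N \<lhd> G \<Longrightarrow> \<rho> (G\<lparr>carrier := N\<rparr>) = \<rho> G \<inter> N"
  and Mod_\<rho>: "group G \<Longrightarrow> finite (carrier G) \<Longrightarrow>
    functorial_at \<rho> (G Mod \<rho> G) = {\<one>\<^bsub>G Mod \<rho> G\<^esub>}"
  using Kurosh_Amitsur
  by (auto simp: hereditary_Kurosh_Amitsur_radical_def hereditary_Plotkin_radical_def
      preserved_by_epi_def)

text \<open>Heredity carries triviality of \<open>\<rho>\<close> down the subnormal chain to
  \<open>L\<close>. A solvable \<open>L\<close> is its own soluble radical, hence contained in its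
  trivial \<open>\<rho>\<close>.\<close>

lemma no_solvable_subnormal_if_\<rho>_trivial:
  fixes H :: "nat monoid"
  assumes "group H" "finite (carrier H)" "\<rho> H = {\<one>\<^bsub>H\<^esub>}"
  shows "no_solvable_subnormal H"
proof -
  interpret group H by fact
  have fin: "finite L" if "subgroup L H" for L
    using assms(2) subgroup.subset[OF that] by (rule rev_finite_subset)
  have triv: "\<rho> (H\<lparr>carrier := L\<rparr>) = {\<one>\<^bsub>H\<^esub>}" if "subnormal H L" for L
    using that
  proof (induction rule: subnormal.induct)
    case self
    then show ?case using assms(3) by simp
  next
    case (step K L)
    have K: "subgroup K H" by (rule subnormal_imp_subgroup[OF step.hyps(1)])
    have "\<one>\<^bsub>H\<^esub> \<in> L" using step.hyps(2) K by (auto simp: normal_in_subgroup_iff subgroup.one_closed)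
    then show ?case
      using hereditary_\<rho>[OF subgroup_imp_group[OF K] _ step.hyps(2)] fin[OF K] step.IH by simp
  qed
  have "L = {\<one>\<^bsub>H\<^esub>}" if L: "subnormal H L" "solvable (H\<lparr>carrier := L\<rparr>)" for L
  proof -
    have LH: "subgroup L H" by (rule subnormal_imp_subgroup[OF L(1)])
    interpret L: group "H\<lparr>carrier := L\<rparr>" using LH by (rule subgroup_imp_group)
    have "soluble_radical (H\<lparr>carrier := L\<rparr>) = L"
      unfolding soluble_radical_def
      using L.normal_self L(2) by (intro Greatest_equality) (auto dest!: normal_imp_subgroup subgroup.subset)
    then show ?thesis
      using soluble_radical_le[OF L.is_group] fin[OF LH] triv[OF L(1)] subgroup.one_closed[OF LH]
      by auto
  qed
  then show ?thesis by (simp add: no_solvable_subnormal_def)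
qed

text \<open>By heredity, used in \<open>M\<close> and in \<open>H\<close>, the radical of
  \<open>M\<close> meets the socle trivially. Both are normal in \<open>M\<close>, so they commute,
  and the socle of \<open>H\<close> has trivial centraliser. Then
  \<open>simple_socle_subgroup_eq\<close> applies.\<close>

lemma \<rho>_trivial_socle_subgroup:
  fixes H :: "nat monoid"
  assumes H: "group H" "finite (carrier H)" "\<rho> H = {\<one>\<^bsub>H\<^esub>}"
    and M: "subgroup M H" "simple_socle H \<subseteq> M"
  shows "\<rho> (H\<lparr>carrier := M\<rparr>) = {\<one>\<^bsub>H\<^esub>}"
    and "simple_socle (H\<lparr>carrier := M\<rparr>) = simple_socle H"
proof -
  interpret group H by fact
  interpret M: group "H\<lparr>carrier := M\<rparr>" using M(1) by (rule subgroup_imp_group)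
  let ?M = "H\<lparr>carrier := M\<rparr>" and ?S = "simple_socle H"
  have finM: "finite (carrier ?M)" using H(2) subgroup.subset[OF M(1)] by (simp add: finite_subset)
  note ns = no_solvable_subnormal_if_\<rho>_trivial
  have S: "?S \<lhd> ?M" by (rule normal_restrict_supergroup[OF M(1) simple_socle_normal M(2)])
  have RM: "\<rho> ?M \<lhd> ?M" by (rule functorial_normal[OF functorial_\<rho> M.is_group finM])
  have "\<rho> ?M \<inter> ?S = {\<one>\<^bsub>H\<^esub>}"
    using hereditary_\<rho>[OF M.is_group finM S] hereditary_\<rho>[OF H(1,2) simple_socle_normal] H(3)
      subgroup.one_closed[OF simple_socle_subgroup] by simp
  moreover have sub: "subgroup (\<rho> ?M) H" "\<rho> ?M \<subseteq> M"
    and conj: "\<And>k n. k \<in> M \<Longrightarrow> n \<in> \<rho> ?M \<Longrightarrow> k \<otimes>\<^bsub>H\<^esub> n \<otimes>\<^bsub>H\<^esub> inv\<^bsub>H\<^esub> k \<in> \<rho> ?M"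
    using RM normal_in_subgroup_iff[OF M(1)] by auto
  ultimately have comm: "x \<otimes>\<^bsub>H\<^esub> y = y \<otimes>\<^bsub>H\<^esub> x" if x: "x \<in> \<rho> ?M" and y: "y \<in> ?S" for x y
  proof -
    interpret S: normal ?S H by (rule simple_socle_normal)
    have car: "x \<in> carrier H" "y \<in> carrier H" using x y subgroup.mem_carrier[OF sub(1)] by auto
    \<comment> \<open>The commutator of \<open>x\<close> and \<open>y\<close> lies in both normal
      subgroups, whose intersection is trivial.\<close>
    have "x \<otimes>\<^bsub>H\<^esub> y \<otimes>\<^bsub>H\<^esub> inv\<^bsub>H\<^esub> x \<otimes>\<^bsub>H\<^esub> inv\<^bsub>H\<^esub> y \<in> ?S"
      using S.inv_op_closed2[OF car(1) y] y by blast
    moreover have "x \<otimes>\<^bsub>H\<^esub> (y \<otimes>\<^bsub>H\<^esub> inv\<^bsub>H\<^esub> x \<otimes>\<^bsub>H\<^esub> inv\<^bsub>H\<^esub> y) \<in> \<rho> ?M"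
      using x conj[of y "inv\<^bsub>H\<^esub> x"] y M(2) sub(1) by (blast intro: subgroup.m_closed subgroup.m_inv_closed)
    ultimately have "x \<otimes>\<^bsub>H\<^esub> y \<otimes>\<^bsub>H\<^esub> inv\<^bsub>H\<^esub> x \<otimes>\<^bsub>H\<^esub> inv\<^bsub>H\<^esub> y = \<one>\<^bsub>H\<^esub>"
      using car \<open>\<rho> ?M \<inter> ?S = {\<one>\<^bsub>H\<^esub>}\<close> by (auto simp: m_assoc)
    then have "x \<otimes>\<^bsub>H\<^esub> y \<otimes>\<^bsub>H\<^esub> inv\<^bsub>H\<^esub> x \<otimes>\<^bsub>H\<^esub> inv\<^bsub>H\<^esub> y \<otimes>\<^bsub>H\<^esub> (y \<otimes>\<^bsub>H\<^esub> x) = y \<otimes>\<^bsub>H\<^esub> x" using car by simp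
    then show ?thesis using car by (simp add: m_assoc)
  qed
  then have "x = \<one>\<^bsub>H\<^esub>" if "x \<in> \<rho> ?M" for x
    using centralizer_simple_socle[OF H(2) ns[OF H]] that subgroup.mem_carrier[OF sub(1)] by metis
  then show triv: "\<rho> ?M = {\<one>\<^bsub>H\<^esub>}" using subgroup.one_closed[OF sub(1)] by blast
  show "simple_socle ?M = ?S"
    using simple_socle_subgroup_eq[OF H(2) M ns[OF H] ns[OF M.is_group finM]] triv by simp
qed

section \<open>The two kinds of step in the series\<close>

abbreviation radical_step :: "('a, 'm) monoid_scheme \<Rightarrow> 'a set \<Rightarrow> 'a set" where
  "radical_step \<equiv> functorial_step \<rho>"

text \<open>One period of the alternating series. The radical step comes first, so the socle is
  taken in a group with trivial \<open>\<rho>\<close>, where it equals F*.\<close>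

definition socle_step :: "('a, 'm) monoid_scheme \<Rightarrow> 'a set \<Rightarrow> 'a set" where
  "socle_step G N = functorial_step simple_socle G (radical_step G N)"

lemma radical_step_idem:
  assumes "group G" "finite (carrier G)" "N \<lhd> G"
  shows "radical_step G (radical_step G N) = radical_step G N"
proof -
  obtain H :: "nat monoid" and q where q: "quotient_map G N H q"
    using quotient_map_nat[OF assms] .
  note Q = quotient_mapD[OF q]
  have n: "\<rho> H \<lhd> H" by (rule functorial_normal[OF functorial_\<rho> Q(3,4)])
  \<comment> \<open>This is (P3): the radical of the quotient is trivial, so its preimage is just
    the kernel \<open>\<rho> H\<close>.\<close>
  have "radical_step H (\<rho> H) = \<rho> H"
    using quotient_mapD(7)[OF quotient_map_Mod[OF Q(3,4) n]] Mod_\<rho>[OF Q(3,4)]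
    by (simp add: functorial_step_def)
  then show ?thesis
    using functorial_step_preimage[OF functorial_\<rho> q n] by (simp add: functorial_step_eq[OF functorial_\<rho> q])
qed

text \<open>The preimage of \<open>\<rho> H\<close> is a second radical step, which by idempotence
  is again the kernel of \<open>q\<close>.\<close>

lemma \<rho>_quotient_trivial:
  fixes H :: "nat monoid"
  assumes q: "quotient_map G (radical_step G N) H q" and N: "N \<lhd> G"
  shows "\<rho> H = {\<one>\<^bsub>H\<^esub>}"
proof -
  note Q = quotient_mapD[OF q]
  have "\<rho> H \<lhd> H" by (rule functorial_normal[OF functorial_\<rho> Q(3,4)])
  then have sub: "subgroup (\<rho> H) H" by (rule normal_imp_subgroup)
  have eq: "{x \<in> carrier G. q x \<in> \<rho> H} = {x \<in> carrier G. q x = \<one>\<^bsub>H\<^esub>}"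
    by (rule trans[OF functorial_step_eq[OF functorial_\<rho> q, symmetric]
          trans[OF radical_step_idem[OF Q(1,2) N] Q(7)]])
  have "y = \<one>\<^bsub>H\<^esub>" if y: "y \<in> \<rho> H" for y
  proof -
    obtain x where "x \<in> carrier G" "y = q x" using y Q(6) subgroup.mem_carrier[OF sub] by blast
    then show ?thesis using eq y by blast
  qed
  then show ?thesis using subgroup.one_closed[OF sub] by blast
qed

lemma
  assumes "group G" "finite (carrier G)" "N \<lhd> G"
  shows radical_step_normal: "radical_step G N \<lhd> G"
    and radical_step_increasing: "N \<subseteq> radical_step G N"
    and socle_step_normal: "socle_step G N \<lhd> G"
    and radical_step_le_socle_step: "radical_step G N \<subseteq> socle_step G N"
    and socle_step_increasing: "N \<subseteq> socle_step G N"
proof -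
  show R: "radical_step G N \<lhd> G" and "N \<subseteq> radical_step G N"
    using functorial_step_normal functorial_step_increasing functorial_\<rho> assms by blast+
  moreover show "socle_step G N \<lhd> G" "radical_step G N \<subseteq> socle_step G N"
    unfolding socle_step_def
    using functorial_step_normal functorial_step_increasing functorial_simple_socle assms(1,2) R
    by blast+
  ultimately show "N \<subseteq> socle_step G N" by blast
qed

lemma socle_steps_normal:
  assumes "group G" "finite (carrier G)" "N \<lhd> G"
  shows "(socle_step G ^^ n) N \<lhd> G" and "N \<subseteq> (socle_step G ^^ n) N"
proof -
  have "(socle_step G ^^ n) N \<lhd> G \<and> N \<subseteq> (socle_step G ^^ n) N"
  proof (induction n)
    case (Suc n)
    then show ?case
      using socle_step_normal[OF assms(1,2)] socle_step_increasing[OF assms(1,2)] by fastforce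
  qed (simp add: assms(3))
  then show "(socle_step G ^^ n) N \<lhd> G" "N \<subseteq> (socle_step G ^^ n) N" by auto
qed

section \<open>Comparing the series of a group with that of a subgroup\<close>

text \<open>Iterates \<open>functorial_step_mono\<close>. Its covering condition persists because
  the terms in \<open>G\<close> only grow beyond \<open>K\<close>.\<close>

lemma radical_steps_mono:
  fixes G (structure)
  assumes G: "group G" "finite (carrier G)" and M: "subgroup M G" and N: "N \<lhd> G\<lparr>carrier := M\<rparr>"
    and K: "K \<lhd> G" and NK: "N \<subseteq> K" and GKM: "carrier G \<subseteq> K <#> M"
  shows "radical_step (G\<lparr>carrier := M\<rparr>) ((socle_step (G\<lparr>carrier := M\<rparr>) ^^ n) N)
    \<subseteq> radical_step G ((socle_step G ^^ n) K)"
proof -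
  let ?M = "G\<lparr>carrier := M\<rparr>"
  have MG: "M \<subseteq> carrier G" using M by (rule subgroup.subset)
  have fM: "group ?M" "finite (carrier ?M)"
    using group.subgroup_imp_group[OF G(1) M] finite_subset[OF MG G(2)] by auto
  have GKM': "carrier G \<subseteq> K' <#> M" if "K \<subseteq> K'" for K'
    using GKM mono_set_mult[OF that subset_refl, of G M] by blast
  have R: "radical_step ?M N' \<subseteq> radical_step G K'"
    if "N' \<lhd> ?M" "K' \<lhd> G" "N' \<subseteq> K'" "K \<subseteq> K'" for N' K'
    using functorial_step_mono[OF functorial_\<rho> preserved_by_epi_\<rho> G M that(1-3) GKM'[OF that(4)]] .
  have B: "socle_step ?M N' \<subseteq> socle_step G K'"
    if "N' \<lhd> ?M" "K' \<lhd> G" "N' \<subseteq> K'" "K \<subseteq> K'" for N' K'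
    unfolding socle_step_def
    using that R radical_step_normal[OF fM] radical_step_normal[OF G]
      radical_step_increasing[OF G that(2)]
    by (intro functorial_step_mono[OF functorial_simple_socle preserved_by_epi_simple_socle G M]
        GKM') auto
  have "(socle_step ?M ^^ n) N \<subseteq> (socle_step G ^^ n) K"
  proof (induction n)
    case (Suc n)
    then show ?case
      using B[OF socle_steps_normal(1)[OF fM N] socle_steps_normal(1)[OF G K] _ socle_steps_normal(2)[OF G K]]
      by simp
  qed (simp add: NK)
  then show ?thesis
    by (rule R[OF socle_steps_normal(1)[OF fM N] socle_steps_normal(1)[OF G K] _ socle_steps_normal(2)[OF G K]])
qed

text \<open>In the quotient by \<open>N\<close>, heredity gives that \<open>\<rho> H\<close> is its
  own radical. As it is normal in the image of \<open>M\<close>, heredity there places it inside the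
  radical of that image.\<close>

lemma radical_step_subgroup_le:
  assumes G: "group G" "finite (carrier G)" and N: "N \<lhd> G" and M: "subgroup M G" "radical_step G N \<subseteq> M"
  shows "radical_step G N \<subseteq> radical_step (G\<lparr>carrier := M\<rparr>) N"
proof -
  obtain H :: "nat monoid" and q where q: "quotient_map G N H q"
    using quotient_map_nat[OF G N] .
  note Q = quotient_mapD[OF q]
  interpret H: group H by (rule Q(3))
  have qM: "subgroup (q ` M) H" by (rule group_hom.subgroup_img_is_subgroup[OF Q(5) M(1)])
  have NM: "N \<subseteq> M" using radical_step_increasing[OF G N] M(2) by blast
  note r = quotient_map_restrict[OF q M(1) NM]
  note R = quotient_mapD[OF r]
  have n: "\<rho> H \<lhd> H" by (rule functorial_normal[OF functorial_\<rho> Q(3,4)])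
  have "\<rho> H \<subseteq> q ` M"
  proof
    fix y assume y: "y \<in> \<rho> H"
    then obtain x where "x \<in> carrier G" "y = q x"
      using Q(6) subgroup.mem_carrier[OF normal_imp_subgroup[OF n]] by blast
    then show "y \<in> q ` M" using y M(2) by (auto simp: functorial_step_eq[OF functorial_\<rho> q])
  qed
  then have "\<rho> H \<lhd> H\<lparr>carrier := q ` M\<rparr>" by (rule H.normal_restrict_supergroup[OF qM n])
  then have "\<rho> (H\<lparr>carrier := \<rho> H\<rparr>) = \<rho> (H\<lparr>carrier := q ` M\<rparr>) \<inter> \<rho> H"
    using hereditary_\<rho>[OF R(3,4)] by simp
  then have "\<rho> H \<subseteq> \<rho> (H\<lparr>carrier := q ` M\<rparr>)" using hereditary_\<rho>[OF Q(3,4) n] by blast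
  then show ?thesis
    using M(2) unfolding functorial_step_eq[OF functorial_\<rho> q] functorial_step_eq[OF functorial_\<rho> r]
    by auto
qed

text \<open>Modulo \<open>?R\<close> the radical of \<open>G\<close> is trivial and the image of
  \<open>M\<close> contains the socle, so \<open>\<rho>_trivial_socle_subgroup\<close> applies.
  Hence the radical step of \<open>M\<close> at \<open>?R\<close> adds nothing, and monotonicity
  bounds the one at \<open>N\<close>; the reverse inclusion is
  \<open>radical_step_subgroup_le\<close>.\<close>

lemma steps_subgroup_eq:
  assumes G: "group G" "finite (carrier G)" and N: "N \<lhd> G" and M: "subgroup M G" "socle_step G N \<subseteq> M"
  shows "radical_step (G\<lparr>carrier := M\<rparr>) N = radical_step G N"
    and "socle_step (G\<lparr>carrier := M\<rparr>) N = socle_step G N"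
proof -
  let ?M = "G\<lparr>carrier := M\<rparr>" and ?R = "radical_step G N"
  have RM: "?R \<subseteq> M" using radical_step_le_socle_step[OF G N] M(2) by blast
  have R: "?R \<lhd> G" by (rule radical_step_normal[OF G N])
  obtain H :: "nat monoid" and q where q: "quotient_map G ?R H q"
    using quotient_map_nat[OF G R] .
  note Q = quotient_mapD[OF q] and r = quotient_map_restrict[OF q M(1) RM]
  have qM: "subgroup (q ` M) H" by (rule group_hom.subgroup_img_is_subgroup[OF Q(5) M(1)])
  have S: "socle_step G N = {x \<in> carrier G. q x \<in> simple_socle H}"
    by (simp add: socle_step_def functorial_step_eq[OF functorial_simple_socle q])
  have "simple_socle H \<subseteq> q ` M"
  proof
    fix y assume y: "y \<in> simple_socle H"
    then obtain x where "x \<in> carrier G" "y = q x"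
      using Q(6) subgroup.mem_carrier[OF group.simple_socle_subgroup[OF Q(3)]] by blast
    then show "y \<in> q ` M" using y M(2) S by auto
  qed
  note core = \<rho>_trivial_socle_subgroup[OF Q(3,4) \<rho>_quotient_trivial[OF q N] qM this]
  have MG: "M \<subseteq> carrier G" using M(1) by (rule subgroup.subset)
  have fM: "group ?M" "finite (carrier ?M)"
    using group.subgroup_imp_group[OF G(1) M(1)] finite_subset[OF MG G(2)] by auto
  have NM: "N \<lhd> ?M" and RM': "?R \<lhd> ?M"
    using group.normal_restrict_supergroup[OF G(1) M(1)] N R RM radical_step_increasing[OF G N] by auto
  have "radical_step ?M N \<subseteq> radical_step ?M ?R"
    by (rule functorial_step_mono_normal[OF functorial_\<rho> preserved_by_epi_\<rho> fM NM RM'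
          radical_step_increasing[OF G N]])
  also have "\<dots> = {x \<in> M. q x = \<one>\<^bsub>H\<^esub>}"
    by (simp add: functorial_step_eq[OF functorial_\<rho> r] core)
  also have "\<dots> \<subseteq> ?R" using Q(7) MG by blast
  finally show eq: "radical_step ?M N = ?R"
    using radical_step_subgroup_le[OF G N M(1) RM] by blast
  show "socle_step ?M N = socle_step G N"
    using M(2) MG unfolding S
    by (auto simp: socle_step_def eq functorial_step_eq[OF functorial_simple_socle r] core)
qed

text \<open>The quotient by the radical step has trivial socle, which every element centralises; as
  the socle has trivial centraliser, the quotient is trivial.\<close>

lemma socle_step_eq_radical_step_imp:
  assumes G: "group G" "finite (carrier G)" and N: "N \<lhd> G" and eq: "socle_step G N = radical_step G N"
  shows "radical_step G N = carrier G"
proof -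
  obtain H :: "nat monoid" and q where q: "quotient_map G (radical_step G N) H q"
    using quotient_map_nat[OF G radical_step_normal[OF G N]] .
  note Q = quotient_mapD[OF q]
  interpret H: group H by (rule Q(3))
  have "y = \<one>\<^bsub>H\<^esub>" if y: "y \<in> simple_socle H" for y
  proof -
    obtain x where x: "x \<in> carrier G" "y = q x"
      using y Q(6) subgroup.mem_carrier[OF H.simple_socle_subgroup] by blast
    then have "x \<in> socle_step G N"
      using y by (simp add: socle_step_def functorial_step_eq[OF functorial_simple_socle q])
    then have "x \<in> radical_step G N" by (simp only: eq)
    then show ?thesis using Q(7) x by blast
  qed
  then have "y = \<one>\<^bsub>H\<^esub>" if "y \<in> carrier H" for y
    using H.centralizer_simple_socle[OF Q(4) no_solvable_subnormal_if_\<rho>_trivial[OF Q(3,4)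
        \<rho>_quotient_trivial[OF q N]] that] that by (metis H.l_one H.r_one)
  then show ?thesis using Q(6,7) by blast
qed

section \<open>Maximal subgroups and their series\<close>

text \<open>Maximality gives that \<open>?S\<close> and \<open>M\<close> together cover
  \<open>G\<close>, so the series of \<open>G\<close> started at \<open>?S\<close> dominates that of
  \<open>M\<close> started at \<open>N\<close>. Its term \<open>?T\<close> contains both
  \<open>M\<close> and \<open>?S\<close>, hence is all of \<open>G\<close>.\<close>

lemma maximal_subgroup_steps_not_le:
  assumes G: "group G" "finite (carrier G)" and M: "maximal_subgroup M G"
    and N: "N \<lhd> G" "N \<subseteq> M" and nle: "\<not> socle_step G N \<subseteq> M"
    and n: "radical_step (G\<lparr>carrier := M\<rparr>) ((socle_step (G\<lparr>carrier := M\<rparr>) ^^ n) N) = M"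
  shows "radical_step G ((socle_step G ^^ Suc n) N) = carrier G"
proof -
  let ?S = "socle_step G N" and ?T = "radical_step G ((socle_step G ^^ n) (socle_step G N))"
  interpret group G by (rule G(1))
  have MG: "subgroup M G" and max: "\<And>K. subgroup K G \<Longrightarrow> M \<subseteq> K \<Longrightarrow> K = M \<or> K = carrier G"
    using M by (auto simp: maximal_subgroup_def)
  have S: "?S \<lhd> G" by (rule socle_step_normal[OF G N(1)])
  have SG: "subgroup ?S G" by (rule normal_imp_subgroup[OF S])
  have le: "M \<subseteq> ?S <#>\<^bsub>G\<^esub> M" "?S \<subseteq> ?S <#>\<^bsub>G\<^esub> M"
    using subgroup.one_closed[OF SG] subgroup.one_closed[OF MG] l_one r_one
      subgroup.mem_carrier[OF SG] subgroup.mem_carrier[OF MG]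
    unfolding set_mult_def by force+
  then have "?S <#>\<^bsub>G\<^esub> M = carrier G"
    using max[OF mult_norm_subgroup[OF S MG]] nle by blast
  then have "M \<subseteq> ?T"
    using radical_steps_mono[OF G MG normal_restrict_supergroup[OF MG N] S
        socle_step_increasing[OF G N(1)], of n] n by simp
  moreover have T: "?T \<lhd> G" "?S \<subseteq> ?T"
    using socle_steps_normal[OF G S] radical_step_normal[OF G] radical_step_increasing[OF G] by blast+
  ultimately have "?T = carrier G"
    using max[OF normal_imp_subgroup] nle by blast
  \<comment> \<open>Starting at \<open>?S\<close> rather than at \<open>N\<close> accounts for the
    one additional step.\<close>
  then show ?thesis by (simp add: funpow_swap1)
qed

text \<open>While the first socle step stays inside \<open>M\<close>, it is common to both series
  and replaces \<open>N\<close>, which is why \<open>N\<close> varies in the induction. Once it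
  leaves \<open>M\<close>, the previous lemma finishes.\<close>

lemma maximal_subgroup_steps:
  assumes G: "group G" "finite (carrier G)" and M: "maximal_subgroup M G"
    and "N \<lhd> G" "N \<subseteq> M"
    and "radical_step (G\<lparr>carrier := M\<rparr>) ((socle_step (G\<lparr>carrier := M\<rparr>) ^^ n) N) = M"
  shows "radical_step G ((socle_step G ^^ Suc n) N) = carrier G"
  using assms(4-6)
proof (induction n arbitrary: N)
  let ?M = "G\<lparr>carrier := M\<rparr>"
  have MG: "subgroup M G" "M \<noteq> carrier G" using M by (auto simp: maximal_subgroup_def)
  {
    case (0 N)
    \<comment> \<open>With no socle steps left, \<open>M\<close> would be the radical step of
      \<open>G\<close>, and a socle step inside \<open>M\<close> would add nothing to it. That
      forces \<open>M\<close> to be all of \<open>G\<close>.\<close>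
    have "socle_step G N \<subseteq> M \<Longrightarrow> False"
    proof -
      assume S: "socle_step G N \<subseteq> M"
      have "radical_step G N = M" using steps_subgroup_eq(1)[OF G 0(1) MG(1) S] 0(3) by simp
      then have "socle_step G N = radical_step G N"
        using radical_step_le_socle_step[OF G 0(1)] S by blast
      then show False
        using socle_step_eq_radical_step_imp[OF G 0(1)] MG(2) \<open>radical_step G N = M\<close> by simp
    qed
    then show ?case using maximal_subgroup_steps_not_le[OF G M 0(1,2) _ 0(3)] by blast
  next
    case (Suc n N)
    show ?case
    proof (cases "socle_step G N \<subseteq> M")
      case True
      have "radical_step ?M ((socle_step ?M ^^ n) (socle_step G N)) = M"
        using Suc.prems(3) steps_subgroup_eq(2)[OF G Suc.prems(1) MG(1) True]
        by (simp add: funpow_swap1)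
      then have "radical_step G ((socle_step G ^^ Suc n) (socle_step G N)) = carrier G"
        by (rule Suc.IH[OF socle_step_normal[OF G Suc.prems(1)] True])
      then show ?thesis by (simp add: funpow_swap1)
    next
      case False
      then show ?thesis
        by (rule maximal_subgroup_steps_not_le[OF G M Suc.prems(1,2) _ Suc.prems(3)])
    qed
  }
qed

section \<open>The \<open>\<gamma>\<close>-series as an alternating series\<close>

lemma steps_preimage:
  assumes q: "quotient_map G N Y q"
  shows "radical_step G (functorial_step simple_socle G N) =
      {x \<in> carrier G. q x \<in> radical_step Y (functorial_step simple_socle Y {\<one>\<^bsub>Y\<^esub>})}"
    and "radical_step G (socle_step G N) =
      {x \<in> carrier G. q x \<in> radical_step Y (socle_step Y {\<one>\<^bsub>Y\<^esub>})}"
proof -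
  note Q = quotient_mapD[OF q]
  note pre = functorial_step_preimage[OF functorial_\<rho> q] functorial_step_preimage[OF functorial_simple_socle q]
  note nor = radical_step_normal[OF Q(3,4)] functorial_step_normal[OF functorial_simple_socle Q(3,4)]
    group.one_is_normal[OF Q(3)]
  have N: "{x \<in> carrier G. q x \<in> {\<one>\<^bsub>Y\<^esub>}} = N" using Q(7) by simp
  show "radical_step G (functorial_step simple_socle G N) =
      {x \<in> carrier G. q x \<in> radical_step Y (functorial_step simple_socle Y {\<one>\<^bsub>Y\<^esub>})}"
    using pre(1)[OF nor(2)[OF nor(3)]] unfolding pre(2)[OF nor(3), symmetric] N by simp
  show "radical_step G (socle_step G N) =
      {x \<in> carrier G. q x \<in> radical_step Y (socle_step Y {\<one>\<^bsub>Y\<^esub>})}"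
    using pre(1)[OF nor(2)[OF nor(1)[OF nor(3)]]]
    unfolding socle_step_def pre(2)[OF nor(1)[OF nor(3)], symmetric] pre(1)[OF nor(3), symmetric] N
    by simp
qed

text \<open>Since \<open>\<rho>\<close> takes only groups on natural numbers, its triviality on
  \<open>Z\<close> is expressed through the isomorphic copies of \<open>Z\<close>. On each copy F*
  is the socle.\<close>

lemma upper_product_Fitting_\<rho>_at:
  assumes "group Z" "finite (carrier Z)"
    and triv: "\<And>(K :: nat monoid) f. group K \<Longrightarrow> f \<in> iso Z K \<Longrightarrow> \<rho> K = {\<one>\<^bsub>K\<^esub>}"
  shows "functorial_at (generalized_Fitting \<star> \<rho>) Z =
    radical_step Z (functorial_step simple_socle Z {\<one>\<^bsub>Z\<^esub>})" (is "_ = ?A")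
proof (rule functorial_at_eqI[OF assms(1,2)])
  show "?A \<subseteq> carrier Z" by (auto simp: functorial_step_def)
next
  fix K :: "nat monoid" and f y
  assume K: "group K" "finite (carrier K)" "f \<in> iso Z K" and y: "y \<in> carrier Z"
  have "generalized_Fitting K = simple_socle K"
    by (rule group.generalized_Fitting_eq_simple_socle[OF K(1)
          no_solvable_subnormal_if_\<rho>_trivial[OF K(1,2) triv[OF K(1,3)]]])
  also have "\<dots> = functorial_step simple_socle K {\<one>\<^bsub>K\<^esub>}"
    by (rule functorial_step_one[OF functorial_simple_socle K(1,2), symmetric])
  finally have "(generalized_Fitting \<star> \<rho>) K =
      radical_step K (functorial_step simple_socle K {\<one>\<^bsub>K\<^esub>})"
    by (simp add: upper_product_def functorial_step_def[of \<rho>])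
  then show "f y \<in> (generalized_Fitting \<star> \<rho>) K \<longleftrightarrow> y \<in> ?A"
    using steps_preimage(1)[OF quotient_map_iso[OF assms(1,2) K(1,3)]] y by simp
qed

text \<open>The quotient by \<open>\<rho> H\<close> has trivial radical, so
  \<open>upper_product_Fitting_\<rho>_at\<close> evaluates the remaining product there; the result
  is pulled back along the coset map.\<close>

lemma upper_product_eq:
  fixes H :: "nat monoid"
  assumes H: "group H" "finite (carrier H)"
  shows "(\<rho> \<star> generalized_Fitting \<star> \<rho>) H = radical_step H (socle_step H {\<one>\<^bsub>H\<^esub>})"
proof -
  have one: "{\<one>\<^bsub>H\<^esub>} \<lhd> H" by (rule group.one_is_normal[OF H(1)])
  have \<rho>: "\<rho> H = radical_step H {\<one>\<^bsub>H\<^esub>}"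
    by (rule functorial_step_one[OF functorial_\<rho> H, symmetric])
  have n: "\<rho> H \<lhd> H" by (rule functorial_normal[OF functorial_\<rho> H])
  note q = quotient_map_Mod[OF H n]
  note Q = quotient_mapD[OF q]
  have "\<rho> K = {\<one>\<^bsub>K\<^esub>}" if K: "group K" "f \<in> iso (H Mod \<rho> H) K" for K :: "nat monoid" and f
  proof -
    have "quotient_map H {x \<in> carrier H. \<rho> H #>\<^bsub>H\<^esub> x \<in> {\<one>\<^bsub>H Mod \<rho> H\<^esub>}} K (f \<circ> (\<lambda>x. \<rho> H #>\<^bsub>H\<^esub> x))"
      by (rule quotient_map_comp[OF q quotient_map_iso[OF Q(3,4) K]])
    also have "{x \<in> carrier H. \<rho> H #>\<^bsub>H\<^esub> x \<in> {\<one>\<^bsub>H Mod \<rho> H\<^esub>}} = radical_step H {\<one>\<^bsub>H\<^esub>}"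
      using Q(7) \<rho> by simp
    finally show ?thesis by (rule \<rho>_quotient_trivial[OF _ one])
  qed
  then have "functorial_at (generalized_Fitting \<star> \<rho>) (H Mod \<rho> H) =
      radical_step (H Mod \<rho> H) (functorial_step simple_socle (H Mod \<rho> H) {\<one>\<^bsub>H Mod \<rho> H\<^esub>})"
    by (rule upper_product_Fitting_\<rho>_at[OF Q(3,4)])
  then have "(\<rho> \<star> generalized_Fitting \<star> \<rho>) H = radical_step H (functorial_step simple_socle H (\<rho> H))"
    unfolding steps_preimage(1)[OF q] by (simp add: upper_product_def[of \<rho>])
  then show ?thesis by (simp add: socle_step_def \<rho>)
qed

lemma functorial_step_upper_product:
  assumes G: "group G" "finite (carrier G)" and N: "N \<lhd> G"
  shows "functorial_step (\<rho> \<star> generalized_Fitting \<star> \<rho>) G N = radical_step G (socle_step G N)"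
proof -
  note q = quotient_map_Mod[OF G N]
  note Q = quotient_mapD[OF q]
  have "functorial_at (\<rho> \<star> generalized_Fitting \<star> \<rho>) (G Mod N) =
      radical_step (G Mod N) (socle_step (G Mod N) {\<one>\<^bsub>G Mod N\<^esub>})" (is "_ = ?A")
  proof (rule functorial_at_eqI[OF Q(3,4)])
    show "?A \<subseteq> carrier (G Mod N)" by (auto simp: functorial_step_def)
  next
    fix H :: "nat monoid" and f y
    assume H: "group H" "finite (carrier H)" "f \<in> iso (G Mod N) H" and y: "y \<in> carrier (G Mod N)"
    show "f y \<in> (\<rho> \<star> generalized_Fitting \<star> \<rho>) H \<longleftrightarrow> y \<in> ?A"
      unfolding upper_product_eq[OF H(1,2)]
      using steps_preimage(2)[OF quotient_map_iso[OF Q(3,4) H(1,3)]] y by simp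
  qed
  then show ?thesis
    unfolding steps_preimage(2)[OF q] by (simp add: functorial_step_def[of "\<rho> \<star> generalized_Fitting \<star> \<rho>"])
qed

abbreviation \<gamma> :: group_functional where
  "\<gamma> \<equiv> \<rho> \<star> generalized_Fitting \<star> \<rho>"

lemma functorial_series_Suc:
  assumes G: "group G" "finite (carrier G)"
  shows "functorial_series \<gamma> G i \<lhd> G"
    and "functorial_series \<gamma> G (Suc i) = radical_step G (socle_step G (functorial_series \<gamma> G i))"
proof -
  have series: "functorial_series \<gamma> G (Suc i) = functorial_step \<gamma> G (functorial_series \<gamma> G i)" for i
    by (simp add: functorial_step_def)
  show n: "functorial_series \<gamma> G i \<lhd> G"
  proof (induction i)
    case 0
    then show ?case using group.one_is_normal[OF G(1)] by simp
  next
    case (Suc i)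
    then show ?case
      unfolding series[of i] functorial_step_upper_product[OF G Suc.IH]
      by (rule radical_step_normal[OF G socle_step_normal[OF G]])
  qed
  show "functorial_series \<gamma> G (Suc i) = radical_step G (socle_step G (functorial_series \<gamma> G i))"
    unfolding series by (rule functorial_step_upper_product[OF G n])
qed

text \<open>The radical ending one \<open>\<gamma>\<close>-step and the radical opening the next
  merge by idempotence. The outer \<open>radical_step\<close> makes the equation hold at index 0
  too, where the series is still trivial.\<close>

lemma radical_step_functorial_series:
  assumes G: "group G" "finite (carrier G)"
  shows "radical_step G (functorial_series \<gamma> G i) = radical_step G ((socle_step G ^^ i) {\<one>\<^bsub>G\<^esub>})"
proof (induction i)
  case (Suc i)
  note n = functorial_series_Suc(1)[OF G, of i]
  have "radical_step G (functorial_series \<gamma> G (Suc i)) =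
      radical_step G (functorial_step simple_socle G (radical_step G (functorial_series \<gamma> G i)))"
    unfolding functorial_series_Suc(2)[OF G] radical_step_idem[OF G socle_step_normal[OF G n]]
    by (simp add: socle_step_def)
  then show ?case by (simp add: Suc.IH socle_step_def)
qed simp

lemma functorial_series_Suc_eq:
  assumes G: "group G" "finite (carrier G)"
  shows "functorial_series \<gamma> G (Suc i) = radical_step G ((socle_step G ^^ Suc i) {\<one>\<^bsub>G\<^esub>})"
  unfolding radical_step_functorial_series[OF G, symmetric] functorial_series_Suc(2)[OF G]
  by (rule radical_step_idem[OF G socle_step_normal[OF G functorial_series_Suc(1)[OF G]], symmetric])

lemma maximal_subgroup_functorial_series:
  assumes G: "group G" "finite (carrier G)" and M: "maximal_subgroup M G"
    and n: "functorial_series \<gamma> (G\<lparr>carrier := M\<rparr>) n = M"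
  shows "functorial_series \<gamma> G (Suc n) = carrier G"
proof -
  let ?M = "G\<lparr>carrier := M\<rparr>"
  have MG: "subgroup M G" using M by (simp add: maximal_subgroup_def)
  have fM: "group ?M" "finite (carrier ?M)"
    using group.subgroup_imp_group[OF G(1) MG] finite_subset[OF subgroup.subset[OF MG] G(2)] by auto
  \<comment> \<open>For \<open>n = 0\<close> the given series term is not yet a radical step;
    applying one more, which leaves \<open>M\<close> unchanged, puts every \<open>n\<close> into the
    form required by \<open>maximal_subgroup_steps\<close>.\<close>
  have "M \<subseteq> radical_step ?M M"
    using radical_step_increasing[OF fM group.normal_self[OF fM(1)]] by simp
  then have "radical_step ?M M = M" by (auto simp: functorial_step_def)
  then have "radical_step ?M ((socle_step ?M ^^ n) {\<one>\<^bsub>G\<^esub>}) = M"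
    using radical_step_functorial_series[OF fM, of n] n by simp
  moreover have "{\<one>\<^bsub>G\<^esub>} \<subseteq> M" using subgroup.one_closed[OF MG] by simp
  ultimately show ?thesis
    unfolding functorial_series_Suc_eq[OF G]
    using maximal_subgroup_steps[OF G M group.one_is_normal[OF G(1)]] by blast
qed

end

section \<open>Lengths as attained minima\<close>

lemma functorial_length_le: "functorial_series \<gamma> G h = carrier G \<Longrightarrow> functorial_length \<gamma> G \<le> enat h"
  unfolding functorial_length_def by (rule Inf_lower) blast

text \<open>The infimum of a nonempty set of extended naturals is its least element, so it is
  attained; the empty set would give infinity.\<close>

lemma functorial_length_finite:
  assumes "functorial_length \<gamma> G < \<infinity>"
  obtains h where "functorial_length \<gamma> G = enat h" "functorial_series \<gamma> G h = carrier G"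
proof -
  let ?A = "{enat h |h. functorial_series \<gamma> G h = carrier G}"
  have "?A \<noteq> {}"
  proof
    assume "?A = {}"
    then show False
      using assms unfolding functorial_length_def \<open>?A = {}\<close> by (simp add: Inf_enat_def)
  qed
  moreover from this have "(LEAST x. x \<in> ?A) \<in> ?A"
    using LeastI_ex[of "\<lambda>x. x \<in> ?A"] by blast
  ultimately have "functorial_length \<gamma> G \<in> ?A"
    unfolding functorial_length_def Inf_enat_def by (simp only: if_False)
  then show ?thesis using that by blast
qed

text \<open>Both lengths are finite, so \<open>the_enat\<close> recovers them; the difference is
  formed in the integers, where subtraction does not truncate.\<close>

theorem theorem3:
  fixes \<rho> :: group_functional and G :: "('a, 'm) monoid_scheme" and M :: "'a set"
  defines "\<gamma> \<equiv> \<rho> \<star> generalized_Fitting \<star> \<rho>"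
  assumes "hereditary_Kurosh_Amitsur_radical \<rho>"
    and "\<And>H :: nat monoid. group H \<Longrightarrow> finite (carrier H) \<Longrightarrow> soluble_radical H \<subseteq> \<rho> H"
    and "group G" and "finite (carrier G)"
    and "maximal_subgroup M G"
    and "functorial_length \<gamma> G < \<infinity>"
    and "functorial_length \<gamma> (G\<lparr>carrier := M\<rparr>) < \<infinity>"
  shows "int (the_enat (functorial_length \<gamma> G))
           - int (the_enat (functorial_length \<gamma> (G\<lparr>carrier := M\<rparr>))) \<le> 1"
proof -
  interpret radical_containing_solvable \<rho>
    using assms(2,3) by unfold_locales
  obtain m where m: "functorial_length \<gamma> (G\<lparr>carrier := M\<rparr>) = enat m"
    "functorial_series \<gamma> (G\<lparr>carrier := M\<rparr>) m = M"
    using functorial_length_finite[OF assms(8)] by auto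
  have "functorial_series \<gamma> G (Suc m) = carrier G"
    using maximal_subgroup_functorial_series[OF assms(4-6)] m(2) by (simp add: \<gamma>_def)
  then have "functorial_length \<gamma> G \<le> enat (Suc m)" by (rule functorial_length_le)
  then show ?thesis using m(1) by (cases "functorial_length \<gamma> G") auto
qed

end
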